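(* All vertex subsets of a graph $G=(V,E)$ that induce connected subgraphs can be enumerated in $O(1)$ (amortized) time for each, using $O(|E|+|V|)$ space.
   Context: For $U\subseteq V$, the subgraph induced by $U$ has vertex set $U$ and all edges of $E$ with both endpoints in $U$. The graph is given by adjacency lists. The time per solution is the total running time divided by the number of such vertex subsets. *)

theory Defs
  imports Complex_Main "Graph_Theory.Digraph_Component"
begin

section \<open>Graphs\<close>

text \<open>
  A finite simple undirected graph is a \<open>pair_graph\<close>, in which every edge is present as two
  opposite arcs.  The set \<open>uedges G\<close> counts each undirected edge once.
\<close>

definition uedges :: "'a pair_pre_digraph \<Rightarrow> 'a set set" where
  "uedges G = {{u, v} | u v. (u, v) \<in> parcs G}"

text \<open>In the library's sense of \<open>connected\<close>, the graph without vertices is not connected.\<close>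

definition connected_vertex_sets :: "'a pair_pre_digraph \<Rightarrow> 'a set set" where
  "connected_vertex_sets G = {U. U \<subseteq> pverts G \<and> connected (with_proj G \<restriction> U)}"

text \<open>The neighbours of a vertex may be listed in any order.\<close>

definition adjacency_lists :: "nat pair_pre_digraph \<Rightarrow> nat list list \<Rightarrow> bool" where
  "adjacency_lists G adj \<longleftrightarrow>
     pverts G = {..<length adj} \<and>
     (\<forall>u < length adj. distinct (adj ! u) \<and> set (adj ! u) = {v. (u, v) \<in> parcs G})"


section \<open>A word RAM\<close>

text \<open>
  A program is a fixed piece of structured code over finitely many registers and a random access
  memory.  Registers and memory cells hold natural numbers.  Every instruction and every evaluation
  of a test costs one unit of time.

  Results are written to a write-only output stream that describes the enumerated sets by
  differences: the events \<open>Ins\<close> and \<open>Del\<close> change the current set, which starts empty, by one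
  element, and \<open>Rep\<close> reports the current set as a solution.  (Spelling out each set in full would
  alone take time proportional to the sum of their cardinalities, which on complete graphs is not
  within a constant factor of their number.)
\<close>

type_synonym reg = nat

datatype test = Less reg reg | Equal reg reg

datatype com =
    Skip
  | Const reg nat
  | Add reg reg reg
  | Sub reg reg reg
  | Load reg reg
  | Store reg reg
  | EmitIns reg
  | EmitDel reg
  | EmitRep
  | Seq com com
  | If test com com
  | While test com

datatype event = Ins nat | Del nat | Rep

type_synonym state = "(reg \<Rightarrow> nat) \<times> (nat \<Rightarrow> nat)"

fun holds :: "test \<Rightarrow> state \<Rightarrow> bool" where
  "holds (Less r q) (R, M) \<longleftrightarrow> R r < R q"
| "holds (Equal r q) (R, M) \<longleftrightarrow> R r = R q"

text \<open>
  \<open>exec W S p s t out s'\<close>: started in \<open>s\<close>, the program \<open>p\<close> halts in \<open>s'\<close> after \<open>t\<close> time units,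
  having written \<open>out\<close>, on a machine with memory cells \<open>0, \<dots>, S - 1\<close> and words with values below
  \<open>W\<close>.  There is no derivation for a run that accesses a cell outside this range or that produces
  a value that does not fit into a word, so \<open>S\<close> bounds the space and \<open>W\<close> the word size.
  Subtraction is truncated at \<open>0\<close>.
\<close>

inductive exec :: "nat \<Rightarrow> nat \<Rightarrow> com \<Rightarrow> state \<Rightarrow> nat \<Rightarrow> event list \<Rightarrow> state \<Rightarrow> bool" for W S where
  Skip: "exec W S Skip s 1 [] s"
| Const: "k < W \<Longrightarrow> exec W S (Const r k) (R, M) 1 [] (R(r := k), M)"
| Add: "R q + R q' < W \<Longrightarrow> exec W S (Add r q q') (R, M) 1 [] (R(r := R q + R q'), M)"
| Sub: "R q - R q' < W \<Longrightarrow> exec W S (Sub r q q') (R, M) 1 [] (R(r := R q - R q'), M)"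
| Load: "R a < S \<Longrightarrow> M (R a) < W \<Longrightarrow> exec W S (Load r a) (R, M) 1 [] (R(r := M (R a)), M)"
| Store: "R a < S \<Longrightarrow> R q < W \<Longrightarrow> exec W S (Store a q) (R, M) 1 [] (R, M(R a := R q))"
| EmitIns: "exec W S (EmitIns r) (R, M) 1 [Ins (R r)] (R, M)"
| EmitDel: "exec W S (EmitDel r) (R, M) 1 [Del (R r)] (R, M)"
| EmitRep: "exec W S EmitRep (R, M) 1 [Rep] (R, M)"
| Seq: "exec W S p s t out s' \<Longrightarrow> exec W S p' s' t' out' s'' \<Longrightarrow>
    exec W S (Seq p p') s (t + t') (out @ out') s''"
| IfTrue: "holds b s \<Longrightarrow> exec W S p s t out s' \<Longrightarrow> exec W S (If b p p') s (1 + t) out s'"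
| IfFalse: "\<not> holds b s \<Longrightarrow> exec W S p' s t out s' \<Longrightarrow> exec W S (If b p p') s (1 + t) out s'"
| WhileFalse: "\<not> holds b s \<Longrightarrow> exec W S (While b p) s 1 [] s"
| WhileTrue: "holds b s \<Longrightarrow> exec W S p s t out s' \<Longrightarrow> exec W S (While b p) s' t' out' s'' \<Longrightarrow>
    exec W S (While b p) s (1 + t + t') (out @ out') s''"

inductive_cases exec_SkipE: "exec W S Skip s t out s'"
  and exec_ConstE: "exec W S (Const r k) s t out s'"
  and exec_AddE: "exec W S (Add r q q') s t out s'"
  and exec_SubE: "exec W S (Sub r q q') s t out s'"
  and exec_LoadE: "exec W S (Load r a) s t out s'"
  and exec_StoreE: "exec W S (Store a q) s t out s'"
  and exec_EmitInsE: "exec W S (EmitIns r) s t out s'"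
  and exec_EmitDelE: "exec W S (EmitDel r) s t out s'"
  and exec_EmitRepE: "exec W S EmitRep s t out s'"
  and exec_SeqE: "exec W S (Seq p p') s t out s'"
  and exec_IfE: "exec W S (If b p p') s t out s'"
  and exec_WhileE: "exec W S (While b p) s t out s'"

lemma exec_deterministic:
  assumes "exec W S p s t out s'" and "exec W S p s t1 out1 s1"
  shows "t1 = t \<and> out1 = out \<and> s1 = s'"
  using assms
proof (induction arbitrary: t1 out1 s1 rule: exec.induct)
  case Skip then show ?case by (auto elim: exec_SkipE)
next
  case Const then show ?case by (auto elim: exec_ConstE)
next
  case Add then show ?case by (auto elim: exec_AddE)
next
  case Sub then show ?case by (auto elim: exec_SubE)
next
  case Load then show ?case by (auto elim: exec_LoadE)
next
  case Store then show ?case by (auto elim: exec_StoreE)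
next
  case EmitIns then show ?case by (auto elim: exec_EmitInsE)
next
  case EmitDel then show ?case by (auto elim: exec_EmitDelE)
next
  case EmitRep then show ?case by (auto elim: exec_EmitRepE)
next
  case (Seq p s t out s' p' t' out' s'')
  from Seq.prems show ?case
  proof (rule exec_SeqE)
    fix u o1 r u' o1'
    assume "t1 = u + u'" "out1 = o1 @ o1'" "exec W S p s u o1 r" "exec W S p' r u' o1' s1"
    with Seq.IH(1)[of u o1 r] Seq.IH(2)[of u' o1' s1] show ?thesis by simp
  qed
next
  case (IfTrue b s p t out s' p')
  from IfTrue.prems show ?case
  proof (rule exec_IfE)
    fix u assume "t1 = Suc u" "exec W S p s u out1 s1"
    with IfTrue.IH[of u out1 s1] show ?thesis by simp
  qed (use IfTrue.hyps in simp)
next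
  case (IfFalse b s p' t out s' p)
  from IfFalse.prems show ?case
  proof (rule exec_IfE)
    fix u assume "t1 = Suc u" "exec W S p' s u out1 s1"
    with IfFalse.IH[of u out1 s1] show ?thesis by simp
  qed (use IfFalse.hyps in simp)
next
  case (WhileFalse b s p)
  from WhileFalse.prems show ?case
    by (rule exec_WhileE) (simp_all add: WhileFalse.hyps)
next
  case (WhileTrue b s p t out s' t' out' s'')
  from WhileTrue.prems show ?case
  proof (rule exec_WhileE)
    fix u o1 r u' o1'
    assume "t1 = Suc (u + u')" "out1 = o1 @ o1'" "exec W S p s u o1 r"
      "exec W S (While b p) r u' o1' s1"
    with WhileTrue.IH(1)[of u o1 r] WhileTrue.IH(2)[of u' o1' s1] show ?thesis by simp
  qed (use WhileTrue.hyps in simp)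
qed

fun reported :: "nat set \<Rightarrow> event list \<Rightarrow> nat set list" where
  "reported U [] = []"
| "reported U (Ins v # es) = reported (insert v U) es"
| "reported U (Del v # es) = reported (U - {v}) es"
| "reported U (Rep # es) = U # reported U es"

definition enumerates :: "event list \<Rightarrow> nat set set \<Rightarrow> bool" where
  "enumerates out F \<longleftrightarrow> distinct (reported {} out) \<and> set (reported {} out) = F"

text \<open>
  Memory image of adjacency lists of a graph with \<open>n\<close> vertices: cell \<open>0\<close> contains \<open>n\<close>, and the
  list of vertex \<open>i\<close> occupies the cells from address \<open>M (i + 1)\<close> up to, but not including,
  address \<open>M (i + 2)\<close>.
\<close>

definition input_image :: "nat list list \<Rightarrow> nat list" where
  "input_image adj =
     length adj
     # map (\<lambda>i. length adj + 2 + length (concat (take i adj))) [0..<length adj + 1]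
     @ concat adj"

definition initial_state :: "nat list list \<Rightarrow> state" where
  "initial_state adj =
     (\<lambda>_. 0, \<lambda>a. if a < length (input_image adj) then input_image adj ! a else 0)"

end

theory Submission
  imports Defs
begin

text \<open>
  The connected sets with largest vertex \<open>r\<close> are enumerated by binary partition.  A node of the
  search tree is given by a set of included vertices, the set \<open>A\<close> of undecided vertices and the
  queue \<open>F\<close> of the undecided neighbours of the included ones.  Its children include or exclude the
  first vertex \<open>v\<close> of \<open>F\<close>, and each leaf, where \<open>F\<close> is empty, reports one set.

  Processing a node takes time \<open>O(1 + d)\<close>, where \<open>d\<close> is the degree of \<open>v\<close> among the undecided
  vertices: in either case \<open>v\<close> is unlinked from the doubly linked lists of its undecided
  neighbours, and it is relinked in reverse order on backtracking.  The time below a node with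
  \<open>l\<close> leaves is at most \<open>K (3 l - |F| - 2)\<close>.  Indeed, if including \<open>v\<close> adds \<open>a\<close> vertices to the
  queue, the two children have queues of lengths \<open>|F| - 1 + a\<close> and \<open>|F| - 1\<close>, and
  \<open>d \<le> |F| - 1 + a\<close>.

  The same bound shows that the number of solutions is at least a third of \<open>|E| + 2 |V|\<close>, which pays for the work outside of the search trees.
\<close>

section \<open>The search tree\<close>

text \<open>The charge of \<open>d\<close> to the queue is what forces the doubly linked lists. It
  covers undecided neighbours only, so a scan of the list of \<open>v\<close> must never meet a
  decided vertex; the number of those is not controlled by the leaves below the node. An unlinked
  list node keeps its own two links, so every removal can be undone exactly and without copying
  (dancing links). The search needs no recursion stack. The decided prefix of the queue, with the
  queue length recorded at each decision, tells which vertex was decided last and which of its two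
  children is being explored. Rooting each set at its largest vertex makes the families of different
  roots disjoint. It also lets the lists grow with the roots: the graph on the vertices up to
  \<open>r\<close> arises from the preceding one by linking in the arcs at \<open>r\<close>. Nothing
  is rebuilt, and all insertions together cost time linear in the input. The subtracted
  \<open>|F|\<close> in the bound acts as a credit. The two children together hold more credit than
  their parent has to pass on, and the surplus pays for scanning the neighbours of
  \<open>v\<close>.\<close>

fun current :: "nat set \<Rightarrow> event list \<Rightarrow> nat set" where
  "current U [] = U"
| "current U (Ins v # es) = current (insert v U) es"
| "current U (Del v # es) = current (U - {v}) es"
| "current U (Rep # es) = current U es"

lemma current_append [simp]: "current U (xs @ ys) = current (current U xs) ys"
  by (induction U xs rule: current.induct) auto

lemma reported_append [simp]:
  "reported U (xs @ ys) = reported U xs @ reported (current U xs) ys"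
  by (induction U xs rule: reported.induct) auto

lemma length_reported: "length (reported U es) = count_list es Rep"
  by (induction U es rule: reported.induct) auto

text \<open>
  The subsets of \<open>A\<close> all of whose elements are reachable inside the subset from its elements
  in \<open>F\<close>.
\<close>

definition grown :: "('a \<times> 'a) set \<Rightarrow> 'a set \<Rightarrow> 'a set \<Rightarrow> 'a set set" where
  "grown E F A = {B. B \<subseteq> A \<and>
     (\<forall>C \<subseteq> B. F \<inter> B \<subseteq> C \<longrightarrow> (\<forall>x\<in>C. \<forall>y\<in>B. (x, y) \<in> E \<longrightarrow> y \<in> C) \<longrightarrow> C = B)}"

lemma grown_subset: "B \<in> grown E F A \<Longrightarrow> B \<subseteq> A"
  unfolding grown_def by simp

lemma grown_closed_eq:
  assumes "B \<in> grown E F A" "C \<subseteq> B" "F \<inter> B \<subseteq> C"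
    and "\<And>x y. x \<in> C \<Longrightarrow> y \<in> B \<Longrightarrow> (x, y) \<in> E \<Longrightarrow> y \<in> C"
  shows "C = B"
proof -
  from assms(1) have "F \<inter> B \<subseteq> C \<longrightarrow> (\<forall>x\<in>C. \<forall>y\<in>B. (x, y) \<in> E \<longrightarrow> y \<in> C) \<longrightarrow> C = B"
    unfolding grown_def using assms(2) by simp
  with assms(3,4) show ?thesis by simp
qed

lemma grown_empty: "grown E {} A = {{}}"
proof -
  have "B = {}" if "B \<in> grown E {} A" for B
    using grown_closed_eq[OF that, of "{}"] by simp
  moreover have "{} \<in> grown E {} A" unfolding grown_def by simp
  ultimately show ?thesis by blast
qed

lemma grown_without:
  assumes "v \<notin> B"
  shows "B \<in> grown E (insert v F) A \<longleftrightarrow> B \<in> grown E F (A - {v})"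
proof -
  have "insert v F \<inter> B = F \<inter> B" "B \<subseteq> A - {v} \<longleftrightarrow> B \<subseteq> A" using assms by auto
  then show ?thesis unfolding grown_def by simp
qed

text \<open>Closed sets correspond: \<open>C\<close> inside \<open>B\<close> becomes
  \<open>insert v C\<close>, and \<open>C\<close> inside \<open>insert v B\<close> becomes
  \<open>C - {v}\<close>. The condition on \<open>F'\<close> looks only at \<open>A - {v}\<close>,
  so the actual queue, which omits decided neighbours of \<open>v\<close>, qualifies.\<close>

lemma grown_with:
  assumes "v \<in> A" "v \<notin> B" "(v, v) \<notin> E"
    and F': "F' \<inter> (A - {v}) = (F \<union> E `` {v}) \<inter> (A - {v})"
  shows "insert v B \<in> grown E (insert v F) A \<longleftrightarrow> B \<in> grown E F' (A - {v})"
proof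
  assume L: "insert v B \<in> grown E (insert v F) A"
  show "B \<in> grown E F' (A - {v})"
    unfolding grown_def
  proof (intro CollectI conjI allI impI)
    show BA: "B \<subseteq> A - {v}" using grown_subset[OF L] \<open>v \<notin> B\<close> by auto
    fix C assume C: "C \<subseteq> B" "F' \<inter> B \<subseteq> C" "\<forall>x\<in>C. \<forall>y\<in>B. (x, y) \<in> E \<longrightarrow> y \<in> C"
    have *: "(F \<union> E `` {v}) \<inter> B \<subseteq> C" using C(2) F' BA by auto
    have "(v, x) \<in> E \<Longrightarrow> x \<in> B \<Longrightarrow> x \<in> C" for x using * by blast
    then have "\<forall>x\<in>insert v C. \<forall>y\<in>insert v B. (x, y) \<in> E \<longrightarrow> y \<in> insert v C"
      using C(3) by simp
    moreover have "insert v F \<inter> insert v B \<subseteq> insert v C" using * by blast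
    moreover have "insert v C \<subseteq> insert v B" using C(1) by blast
    ultimately have "insert v C = insert v B"
      using L unfolding grown_def by simp
    then show "C = B" using \<open>v \<notin> B\<close> C(1) by (metis Diff_insert_absorb subsetD)
  qed
next
  assume R: "B \<in> grown E F' (A - {v})"
  show "insert v B \<in> grown E (insert v F) A"
    unfolding grown_def
  proof (intro CollectI conjI allI impI)
    show "insert v B \<subseteq> A" using grown_subset[OF R] \<open>v \<in> A\<close> by auto
    fix C assume C: "C \<subseteq> insert v B" "insert v F \<inter> insert v B \<subseteq> C"
      "\<forall>x\<in>C. \<forall>y\<in>insert v B. (x, y) \<in> E \<longrightarrow> y \<in> C"
    have BA: "B \<subseteq> A - {v}" by (rule grown_subset[OF R])
    have "v \<in> C" using C(2) by auto
    have FB: "F' \<inter> B = (F \<union> E `` {v}) \<inter> B" using F' BA by blast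
    have "y \<in> C" if "y \<in> B" "(v, y) \<in> E" for y using C(3) \<open>v \<in> C\<close> that by simp
    then have "F' \<inter> B \<subseteq> C - {v}" unfolding FB using C(2) \<open>v \<notin> B\<close> by auto
    from grown_closed_eq[OF R _ this] have "C - {v} = B" using C \<open>v \<notin> B\<close> by blast
    then show "C = insert v B" using \<open>v \<in> C\<close> by auto
  qed
qed

lemma grown_insert:
  assumes "v \<in> A" "(v, v) \<notin> E"
    and "F' \<inter> (A - {v}) = (F \<union> E `` {v}) \<inter> (A - {v})"
  shows "grown E (insert v F) A = insert v ` grown E F' (A - {v}) \<union> grown E F (A - {v})"
    (is "?L = ?R")
proof (rule set_eqI)
  fix B
  have sub: "v \<notin> X" if "X \<in> grown E G (A - {v})" for X G
    using grown_subset[OF that] by auto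
  show "B \<in> ?L \<longleftrightarrow> B \<in> ?R"
  proof (cases "v \<in> B")
    case True
    then have "B \<in> insert v ` grown E F' (A - {v}) \<longleftrightarrow> B - {v} \<in> grown E F' (A - {v})"
      using sub by (metis (no_types, lifting) Diff_insert_absorb image_iff insert_Diff)
    then show ?thesis
      using grown_with[OF assms(1) _ assms(2,3), of "B - {v}"] True sub[of B F]
      by (auto simp: insert_absorb)
  next
    case False
    then show ?thesis using grown_without[OF False] by auto
  qed
qed

text \<open>\<open>S\<close> is the set of vertices included so far. An output consists of
  differences, so its meaning depends on \<open>S\<close>; requiring that \<open>S\<close> be
  current again at the end is what makes outputs of sibling subtrees composable.\<close>

definition enumerates_grown :: "(nat \<times> nat) set \<Rightarrow> nat set \<Rightarrow> nat set \<Rightarrow> event list \<Rightarrow> bool" where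
  "enumerates_grown E F A out \<longleftrightarrow> (\<forall>S. S \<inter> A = {} \<longrightarrow>
     distinct (reported S out) \<and> set (reported S out) = (\<union>) S ` grown E F A \<and> current S out = S)"

lemma enumerates_grown_leaf: "enumerates_grown E {} A [Rep]"
  unfolding enumerates_grown_def by (simp add: grown_empty)

lemma enumerates_grown_node:
  assumes v: "v \<in> A" "(v, v) \<notin> E"
    and F': "F' \<inter> (A - {v}) = (F \<union> E `` {v}) \<inter> (A - {v})"
    and 1: "enumerates_grown E F' (A - {v}) out1"
    and 2: "enumerates_grown E F (A - {v}) out2"
  shows "enumerates_grown E (insert v F) A (Ins v # out1 @ Del v # out2)"
  unfolding enumerates_grown_def
proof (intro allI impI)
  fix S assume S: "S \<inter> A = {}"
  then have vS: "v \<notin> S" using v by auto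
  have "insert v S \<inter> (A - {v}) = {}" "S \<inter> (A - {v}) = {}" using S by auto
  note inst = 1[unfolded enumerates_grown_def, rule_format, OF this(1)]
    2[unfolded enumerates_grown_def, rule_format, OF this(2)]
  have 1: "distinct (reported (insert v S) out1)"
    "set (reported (insert v S) out1) = (\<union>) (insert v S) ` grown E F' (A - {v})"
    "current (insert v S) out1 = insert v S"
    using inst(1) by auto
  have 2: "distinct (reported S out2)"
    "set (reported S out2) = (\<union>) S ` grown E F (A - {v})" "current S out2 = S"
    using inst(2) by auto
  \<comment> \<open>Sets from the first child contain \<open>v\<close>, those from the second do
    not.\<close>
  have disj: "(\<union>) (insert v S) ` grown E F' (A - {v}) \<inter> (\<union>) S ` grown E F (A - {v}) = {}"
  proof -
    have "insert v S \<union> B \<noteq> S \<union> B'" if "B' \<in> grown E F (A - {v})" for B B'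
      using vS grown_subset[OF that] by blast
    then show ?thesis by blast
  qed
  have "(\<union>) S ` grown E (insert v F) A
    = (\<union>) (insert v S) ` grown E F' (A - {v}) \<union> (\<union>) S ` grown E F (A - {v})"
    unfolding grown_insert[OF v F'] by (simp add: image_Un image_image)
  then show "distinct (reported S (Ins v # out1 @ Del v # out2)) \<and>
    set (reported S (Ins v # out1 @ Del v # out2)) = (\<union>) S ` grown E (insert v F) A \<and>
    current S (Ins v # out1 @ Del v # out2) = S"
    using 1 2 disj vS by simp
qed

text \<open>The arcs are symmetric, so connectedness means that all of \<open>U\<close> is reachable
  from \<open>r\<close>. The vertices other than \<open>r\<close> reachable from it form the least
  closed set containing the neighbours of \<open>r\<close>, and \<open>grown\<close> says that this
  set is everything.\<close>

lemma grown_connected: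
  assumes G: "pair_graph G" and r: "r \<in> U" and U: "U \<subseteq> pverts G"
  shows "connected (with_proj G \<restriction> U) \<longleftrightarrow> U - {r} \<in> grown (parcs G) (parcs G `` {r}) (U - {r})"
proof -
  interpret pair_graph G by (rule G)
  let ?H = "with_proj G \<restriction> U"
  have sym: "(y, x) \<in> parcs G" if "(x, y) \<in> parcs G" for x y
    using pair_sym_arcs that by (auto simp: symmetric_def sym_def)
  have irrefl: "(x, x) \<notin> parcs G" for x using pair_no_loops[of "(x, x)"] by auto
  let ?A = "{(x, y). x \<in> U \<and> y \<in> U \<and> (x, y) \<in> parcs G}"
  have arcs: "parcs (mk_symmetric ?H) = ?A"
    by (auto simp: parcs_mk_symmetric induce_subgraph_def sym)
  have conn: "connected ?H \<longleftrightarrow> (\<forall>u\<in>U. \<forall>v\<in>U. (u, v) \<in> rtrancl_on U ?A)"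
    using r by (auto simp: connected_def strongly_connected_def reachable_def arcs)
  \<comment> \<open>\<open>rtrancl_on U\<close> is reflexive on \<open>U\<close> only, hence the
    condition on the starting point.\<close>
  have rtr: "(u, v) \<in> rtrancl_on U ?A \<longleftrightarrow> (u, v) \<in> ?A\<^sup>*" if "u \<in> U" for u v
  proof
    assume "(u, v) \<in> rtrancl_on U ?A"
    then show "(u, v) \<in> ?A\<^sup>*"
      by (induction) (auto intro: converse_rtrancl_into_rtrancl)
  next
    assume "(u, v) \<in> ?A\<^sup>*"
    then show "(u, v) \<in> rtrancl_on U ?A"
      using that by (induction) (auto intro: rtrancl_on_into_rtrancl_on)
  qed
  have "sym ?A" by (auto simp: sym_def sym)
  then have symr: "sym (?A\<^sup>*)" by (rule sym_rtrancl)
  have "connected ?H \<longleftrightarrow> (\<forall>v\<in>U. (r, v) \<in> ?A\<^sup>*)"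
    unfolding conn using rtr r symr by (metis (no_types, lifting) rtrancl_trans symE)
  also have "\<dots> \<longleftrightarrow> U - {r} \<in> grown (parcs G) (parcs G `` {r}) (U - {r})"
  proof
    assume L: "\<forall>v\<in>U. (r, v) \<in> ?A\<^sup>*"
    show "U - {r} \<in> grown (parcs G) (parcs G `` {r}) (U - {r})"
      unfolding grown_def
    proof (intro CollectI conjI allI impI subset_refl)
      fix C assume C: "C \<subseteq> U - {r}" "parcs G `` {r} \<inter> (U - {r}) \<subseteq> C"
        "\<forall>x\<in>C. \<forall>y\<in>U - {r}. (x, y) \<in> parcs G \<longrightarrow> y \<in> C"
      have "v \<in> insert r C" if "(r, v) \<in> ?A\<^sup>*" for v
        using that
      proof (induction)
        case (step y z)
        then show ?case using C by blast
      qed simp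
      then show "C = U - {r}" using L C(1) by blast
    qed
  next
    assume R: "U - {r} \<in> grown (parcs G) (parcs G `` {r}) (U - {r})"
    let ?C = "{v \<in> U - {r}. (r, v) \<in> ?A\<^sup>*}"
    have "?C = U - {r}"
      by (rule grown_closed_eq[OF R]) (use r in \<open>auto intro: rtrancl_into_rtrancl\<close>)
    then show "\<forall>v\<in>U. (r, v) \<in> ?A\<^sup>*" by blast
  qed
  finally show ?thesis .
qed

lemma grown_connected_vertex_sets:
  fixes G :: "nat pair_pre_digraph"
  assumes G: "pair_graph G" and V: "pverts G = {..<n}" and "r < n"
    and F: "F \<inter> {..<r} = parcs G `` {r} \<inter> {..<r}"
  shows "insert r ` grown (parcs G) F {..<r}
    = {U \<in> connected_vertex_sets G. r \<in> U \<and> U \<subseteq> {..r}}" (is "?L = ?R")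
proof -
  \<comment> \<open>For \<open>B\<close> inside \<open>A\<close>, membership in \<open>grown\<close>
    looks only at \<open>B\<close> and at the seeds within \<open>B\<close>.\<close>
  have restrict: "B \<in> grown (parcs G) F {..<r} \<longleftrightarrow> B \<in> grown (parcs G) (parcs G `` {r}) B"
    if "B \<subseteq> {..<r}" for B
  proof -
    have "F \<inter> B = parcs G `` {r} \<inter> B" using F that by blast
    then show ?thesis using that unfolding grown_def by simp
  qed
  have iff: "insert r B \<in> connected_vertex_sets G \<longleftrightarrow> B \<in> grown (parcs G) F {..<r}"
    if "B \<subseteq> {..<r}" for B
  proof -
    have "r \<notin> B" using that by auto
    then have e: "insert r B - {r} = B" by simp
    have "insert r B \<subseteq> pverts G" using that V \<open>r < n\<close> by auto
    then show ?thesis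
      using grown_connected[OF G _ \<open>insert r B \<subseteq> pverts G\<close>, of r] restrict[OF that]
      unfolding connected_vertex_sets_def e by simp
  qed
  show ?thesis
  proof (intro set_eqI iffI)
    fix U assume "U \<in> ?L"
    then obtain B where B: "U = insert r B" "B \<in> grown (parcs G) F {..<r}" by auto
    have "B \<subseteq> {..<r}" by (rule grown_subset[OF B(2)])
    then show "U \<in> ?R" using B iff by auto
  next
    fix U assume U: "U \<in> ?R"
    have U': "insert r (U - {r}) = U" "U - {r} \<subseteq> {..<r}" using U by auto
    then have "U - {r} \<in> grown (parcs G) F {..<r}" using iff[of "U - {r}"] U by simp
    then show "U \<in> ?L" using U'(1)[symmetric] by (rule rev_image_eqI)
  qed
qed

section \<open>Weakest preconditions\<close>

text \<open>As \<open>exec\<close> is deterministic, the existence of a run already gives total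
  correctness. One postcondition collects time, output and final state, and a run without derivation
  (overflow, address out of range) is excluded.\<close>

definition wp :: "nat \<Rightarrow> nat \<Rightarrow> com \<Rightarrow> (nat \<Rightarrow> event list \<Rightarrow> state \<Rightarrow> bool) \<Rightarrow> state \<Rightarrow> bool" where
  "wp W S p Q s \<longleftrightarrow> (\<exists>t out s'. exec W S p s t out s' \<and> Q t out s')"

lemma wp_mono:
  assumes "wp W S p Q s" and "\<And>t out s'. Q t out s' \<Longrightarrow> Q' t out s'"
  shows "wp W S p Q' s"
  using assms unfolding wp_def by blast

lemma wp_Skip [simp]: "wp W S Skip Q s \<longleftrightarrow> Q 1 [] s"
  unfolding wp_def by (rule iffI, fastforce elim: exec_SkipE, blast intro: exec.Skip)

lemma wp_Const [simp]: "wp W S (Const r k) Q (R, M) \<longleftrightarrow> k < W \<and> Q 1 [] (R(r := k), M)"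
  unfolding wp_def by (rule iffI, fastforce elim: exec_ConstE, blast intro: exec.Const)

lemma wp_Add [simp]:
  "wp W S (Add r q q') Q (R, M) \<longleftrightarrow> R q + R q' < W \<and> Q 1 [] (R(r := R q + R q'), M)"
  unfolding wp_def by (rule iffI, fastforce elim: exec_AddE, blast intro: exec.Add)

lemma wp_Sub [simp]:
  "wp W S (Sub r q q') Q (R, M) \<longleftrightarrow> R q - R q' < W \<and> Q 1 [] (R(r := R q - R q'), M)"
  unfolding wp_def by (rule iffI, fastforce elim: exec_SubE, blast intro: exec.Sub)

lemma wp_Load [simp]:
  "wp W S (Load r a) Q (R, M) \<longleftrightarrow> R a < S \<and> M (R a) < W \<and> Q 1 [] (R(r := M (R a)), M)"
  unfolding wp_def by (rule iffI, fastforce elim: exec_LoadE, blast intro: exec.Load)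

lemma wp_Store [simp]:
  "wp W S (Store a q) Q (R, M) \<longleftrightarrow> R a < S \<and> R q < W \<and> Q 1 [] (R, M(R a := R q))"
  unfolding wp_def by (rule iffI, fastforce elim: exec_StoreE, blast intro: exec.Store)

lemma wp_EmitIns [simp]: "wp W S (EmitIns r) Q (R, M) \<longleftrightarrow> Q 1 [Ins (R r)] (R, M)"
  unfolding wp_def by (rule iffI, fastforce elim: exec_EmitInsE, blast intro: exec.EmitIns)

lemma wp_EmitDel [simp]: "wp W S (EmitDel r) Q (R, M) \<longleftrightarrow> Q 1 [Del (R r)] (R, M)"
  unfolding wp_def by (rule iffI, fastforce elim: exec_EmitDelE, blast intro: exec.EmitDel)

lemma wp_EmitRep [simp]: "wp W S EmitRep Q (R, M) \<longleftrightarrow> Q 1 [Rep] (R, M)"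
  unfolding wp_def by (rule iffI, fastforce elim: exec_EmitRepE, blast intro: exec.EmitRep)

lemma wp_Seq [simp]:
  "wp W S (Seq p p') Q s \<longleftrightarrow>
    wp W S p (\<lambda>t out s'. wp W S p' (\<lambda>t' out'. Q (t + t') (out @ out')) s') s"
  unfolding wp_def by (blast intro: exec.Seq elim!: exec_SeqE)

lemma wp_If [simp]:
  "wp W S (If b p p') Q s \<longleftrightarrow>
    (if holds b s then wp W S p (\<lambda>t. Q (1 + t)) s else wp W S p' (\<lambda>t. Q (1 + t)) s)"
proof (cases "holds b s")
  case True
  then show ?thesis
    unfolding wp_def by (simp, intro iffI) (fastforce elim: exec_IfE, metis exec.IfTrue plus_1_eq_Suc)
next
  case False
  then show ?thesis
    unfolding wp_def by (simp, intro iffI) (fastforce elim: exec_IfE, metis exec.IfFalse plus_1_eq_Suc)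
qed

text \<open>Not a simp rule, since its right-hand side contains the same loop again; each loop below
  is unfolded once inside an induction.\<close>

lemma wp_While:
  "wp W S (While b p) Q s \<longleftrightarrow>
    (if holds b s
     then wp W S p (\<lambda>t out s'. wp W S (While b p) (\<lambda>t' out'. Q (1 + t + t') (out @ out')) s') s
     else Q 1 [] s)"
proof (cases "holds b s")
  case True
  show ?thesis
  proof
    assume "wp W S (While b p) Q s"
    with True show "if holds b s
     then wp W S p (\<lambda>t out s'. wp W S (While b p) (\<lambda>t' out'. Q (1 + t + t') (out @ out')) s') s
     else Q 1 [] s"
      unfolding wp_def by (fastforce elim: exec_WhileE)
  next
    assume "if holds b s
     then wp W S p (\<lambda>t out s'. wp W S (While b p) (\<lambda>t' out'. Q (1 + t + t') (out @ out')) s') s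
     else Q 1 [] s"
    with True show "wp W S (While b p) Q s"
      unfolding wp_def by (simp del: plus_1_eq_Suc One_nat_def) (blast intro: exec.WhileTrue)
  qed
next
  case False
  have "wp W S (While b p) Q s \<longleftrightarrow> Q 1 [] s"
    unfolding wp_def using exec.WhileFalse[OF False] exec_deterministic by metis
  with False show ?thesis by simp
qed

lemma wp_While_step:
  assumes "holds b s"
    and "wp W S p (\<lambda>t out s'. wp W S (While b p) (\<lambda>t' out'. Q (1 + t + t') (out @ out')) s') s"
  shows "wp W S (While b p) Q s"
  using assms by (subst wp_While) simp

lemma wp_While_stop: "\<not> holds b s \<Longrightarrow> Q 1 [] s \<Longrightarrow> wp W S (While b p) Q s"
  by (subst wp_While) simp

section \<open>Doubly linked lists\<close>

type_synonym links = "(nat \<Rightarrow> nat) \<times> (nat \<Rightarrow> nat)"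

text \<open>The end points \<open>a\<close> and \<open>b\<close> are sentinels and may coincide,
  which yields a circular list. Unlinking and relinking then need no case distinction for the ends
  of a list.\<close>

fun dll :: "links \<Rightarrow> nat \<Rightarrow> nat list \<Rightarrow> nat \<Rightarrow> bool" where
  "dll (nx, pv) a [] b \<longleftrightarrow> nx a = b \<and> pv b = a"
| "dll (nx, pv) a (x # xs) b \<longleftrightarrow> nx a = x \<and> pv x = a \<and> dll (nx, pv) x xs b"

fun unlink :: "links \<Rightarrow> nat \<Rightarrow> links" where
  "unlink (nx, pv) y = (nx(pv y := nx y), pv(nx y := pv y))"

fun relink :: "links \<Rightarrow> nat \<Rightarrow> links" where
  "relink (nx, pv) y = (nx(pv y := y), pv(nx y := y))"

fun link_after :: "links \<Rightarrow> nat \<Rightarrow> nat \<Rightarrow> links" where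
  "link_after (nx, pv) a y = (nx(a := y, y := nx a), pv(y := a, nx a := y))"

lemma dll_cong:
  assumes "\<And>z. z \<in> set (a # xs) \<Longrightarrow> fst l' z = fst l z"
    and "\<And>z. z \<in> set (xs @ [b]) \<Longrightarrow> snd l' z = snd l z"
  shows "dll l' a xs b \<longleftrightarrow> dll l a xs b"
  using assms
proof (induction l a xs b rule: dll.induct)
  case (1 nx pv a b)
  then show ?case by (cases l') auto
next
  case (2 nx pv a x xs b)
  then show ?case by (cases l') auto
qed

lemma dll_append:
  "dll l a (xs @ y # ys) b \<longleftrightarrow> dll l a xs y \<and> dll l y ys b"
  by (induction l a xs b rule: dll.induct) auto

lemma dll_next: "dll l a xs b \<Longrightarrow> fst l a = hd (xs @ [b])"
  by (cases l; cases xs) auto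

lemma dll_prev: "dll l a xs b \<Longrightarrow> snd l b = last (a # xs)"
  by (induction l a xs b rule: dll.induct) auto

text \<open>Distinctness is required separately with \<open>a\<close> and with \<open>b\<close>, so
  that circular lists with \<open>a = b\<close> are included.\<close>

lemma dll_unlink:
  assumes "dll l a (xs @ y # ys) b" "distinct (a # xs @ y # ys)" "distinct (xs @ y # ys @ [b])"
  shows "dll (unlink l y) a (xs @ ys) b"
  using assms
proof (induction xs arbitrary: a)
  case Nil
  obtain nx pv where l: "l = (nx, pv)" by (cases l)
  show ?case
  proof (cases ys)
    case Nil
    then show ?thesis using Nil.prems l by auto
  next
    case (Cons z zs)
    have "dll (unlink l y) z zs b \<longleftrightarrow> dll l z zs b"
      using Nil.prems l Cons by (intro dll_cong) auto
    then show ?thesis using Nil.prems l Cons by auto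
  qed
next
  case (Cons x xs)
  obtain nx pv where l: "l = (nx, pv)" by (cases l)
  have d: "dll l x xs y" "dll l y ys b" "nx a = x" "pv x = a"
    using Cons.prems(1) l by (auto simp: dll_append)
  have p: "pv y = last (x # xs)" using dll_prev[OF d(1)] l by simp
  have q: "nx y = hd (ys @ [b])" using dll_next[OF d(2)] l by simp
  have "pv y \<noteq> a" using Cons.prems(2) unfolding p by (cases xs rule: rev_cases) auto
  moreover have "nx y \<noteq> x" using Cons.prems(3) unfolding q by (cases ys) auto
  moreover have "dll (unlink l y) x (xs @ ys) b"
    using Cons.prems l by (intro Cons.IH) auto
  ultimately show ?case using d l by simp
qed

text \<open>Unlinking writes only into the two list neighbours of \<open>y\<close>, which differ
  from \<open>y\<close>. The links of \<open>y\<close> thus still point to both places that have to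
  be repaired.\<close>

lemma relink_unlink:
  assumes "dll l a (xs @ y # ys) b" "y \<noteq> a" "y \<noteq> b" "y \<notin> set xs" "y \<notin> set ys"
  shows "relink (unlink l y) y = l"
proof -
  obtain nx pv where l: "l = (nx, pv)" by (cases l)
  have d: "dll l a xs y" "dll l y ys b" using assms(1) by (auto simp: dll_append)
  have p: "pv y = last (a # xs)" using dll_prev[OF d(1)] l by simp
  have q: "nx y = hd (ys @ [b])" using dll_next[OF d(2)] l by simp
  have np: "nx (pv y) = y"
    using d(1) l unfolding p by (cases xs rule: rev_cases) (auto simp: dll_append)
  have pq: "pv (nx y) = y"
    using d(2) l unfolding q by (cases ys) auto
  have "pv y \<noteq> y" using assms unfolding p by (cases xs rule: rev_cases) auto
  moreover have "nx y \<noteq> y" using assms unfolding q by (cases ys) auto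
  ultimately show ?thesis using np pq l by auto
qed

lemma dll_link_after:
  assumes "dll l a xs b" "y \<notin> set (a # xs)" "y \<noteq> b" "distinct (a # xs)" "distinct (xs @ [b])"
  shows "dll (link_after l a y) a (y # xs) b"
proof -
  obtain nx pv where l: "l = (nx, pv)" by (cases l)
  show ?thesis
  proof (cases xs)
    case Nil
    then show ?thesis using assms l by auto
  next
    case (Cons z zs)
    have "dll (link_after l a y) z zs b \<longleftrightarrow> dll l z zs b"
      using assms l Cons by (intro dll_cong) auto
    then show ?thesis using assms l Cons by auto
  qed
qed

section \<open>Adjacency lists of the remaining graph\<close>

locale adjacency =
  fixes E :: "(nat \<times> nat) set" and adj :: "nat list list"
  assumes sym: "(u, v) \<in> E \<Longrightarrow> (v, u) \<in> E"
    and irrefl: "(u, u) \<notin> E"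
    and verts: "(u, v) \<in> E \<Longrightarrow> u < length adj"
    and adj: "u < length adj \<Longrightarrow> distinct (adj ! u) \<and> set (adj ! u) = {v. (u, v) \<in> E}"
begin

section \<open>Addresses of arcs and their list nodes\<close>

abbreviation n where "n \<equiv> length adj"

definition offset :: "nat \<Rightarrow> nat" where
  "offset u = n + 2 + length (concat (take u adj))"

definition D :: nat where "D = offset n"

text \<open>
  The arc from \<open>u\<close> to a smaller \<open>v\<close> is represented by its address in the input, the opposite arc
  by that address plus \<open>D\<close>; the vertices below \<open>n\<close> are the sentinels of their lists.
\<close>

definition index :: "nat \<Rightarrow> nat \<Rightarrow> nat" where
  "index u v = (LEAST j. adj ! u ! j = v)"

definition node :: "nat \<Rightarrow> nat \<Rightarrow> nat" where
  "node u v = (if v < u then offset u + index u v else offset v + index v u + D)"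

lemma verts2: "(u, v) \<in> E \<Longrightarrow> v < n"
  using sym verts by blast

lemma offset_Suc: "u < n \<Longrightarrow> offset (Suc u) = offset u + length (adj ! u)"
  unfolding offset_def by (simp add: take_Suc_conv_app_nth)

lemma offset_mono: "u \<le> v \<Longrightarrow> offset u \<le> offset v"
proof -
  assume "u \<le> v"
  then have "take v adj = take u adj @ take (v - u) (drop u adj)"
    by (metis le_add_diff_inverse take_add)
  then show ?thesis unfolding offset_def by simp
qed

lemma n_less_D: "n < D"
  unfolding D_def offset_def by simp

lemma index:
  assumes "(u, v) \<in> E"
  shows "index u v < length (adj ! u)" "adj ! u ! index u v = v"
proof -
  have "v \<in> set (adj ! u)" using adj verts assms by auto
  then obtain j where j: "j < length (adj ! u)" "adj ! u ! j = v" by (auto simp: in_set_conv_nth)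
  show "adj ! u ! index u v = v" unfolding index_def using j(2) by (rule LeastI)
  have "index u v \<le> j" unfolding index_def using j(2) by (rule Least_le)
  then show "index u v < length (adj ! u)" using j(1) by simp
qed

lemma index_nth:
  assumes "u < n" "j < length (adj ! u)"
  shows "index u (adj ! u ! j) = j"
proof -
  have "(u, adj ! u ! j) \<in> E" using adj[OF assms(1)] assms(2) nth_mem by blast
  from index[OF this] show ?thesis
    using adj[OF assms(1)] assms(2) by (simp add: nth_eq_iff_index_eq)
qed

lemma arc_address:
  assumes "(u, v) \<in> E"
  shows "n + 2 \<le> offset u + index u v" "offset u + index u v < offset (Suc u)"
    "offset u + index u v < D"
proof -
  show "n + 2 \<le> offset u + index u v" unfolding offset_def by simp
  show "offset u + index u v < offset (Suc u)"
    using index(1)[OF assms] offset_Suc[OF verts[OF assms]] by simp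
  also have "\<dots> \<le> D" unfolding D_def using verts[OF assms] by (intro offset_mono) simp
  finally show "offset u + index u v < D" .
qed

text \<open>The lists of different vertices occupy disjoint address intervals, and within one list
  the position determines the entry.\<close>

lemma arc_address_inj:
  assumes "(u, v) \<in> E" "(u', v') \<in> E" "offset u + index u v = offset u' + index u' v'"
  shows "u = u' \<and> v = v'"
proof -
  have "u = u'"
  proof (rule ccontr)
    assume "u \<noteq> u'"
    then have "offset (Suc u) \<le> offset u' \<or> offset (Suc u') \<le> offset u"
      by (metis Suc_leI linorder_neqE_nat offset_mono)
    then show False
      using arc_address(2)[OF assms(1)] arc_address(2)[OF assms(2)] assms(3) by linarith
  qed
  then show ?thesis using assms index by (metis add_left_imp_eq)
qed

lemma node_sym_less:
  assumes "(u, v) \<in> E"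
  shows "node u v < D \<longleftrightarrow> v < u" "v < u \<Longrightarrow> node v u = node u v + D"
  using arc_address(3)[OF assms] arc_address(3)[OF sym[OF assms]]
  unfolding node_def by auto

lemma node_bounds:
  assumes "(u, v) \<in> E"
  shows "n \<le> node u v" "node u v < 2 * D"
  using arc_address[OF assms] arc_address[OF sym[OF assms]] unfolding node_def by auto

text \<open>The opposite arc is found by one comparison and one addition or subtraction, without
  stored cross pointers.\<close>

lemma node_twin:
  assumes "(u, v) \<in> E"
  shows "node v u = (if node u v < D then node u v + D else node u v - D)"
proof -
  have "u \<noteq> v" using assms irrefl by auto
  then show ?thesis
    using node_sym_less[OF assms] node_sym_less[OF sym[OF assms]] by auto
qed

lemma node_inj:
  assumes "(u, v) \<in> E" "(u', v') \<in> E" "node u v = node u' v'"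
  shows "u = u' \<and> v = v'"
proof -
  have "v < u \<longleftrightarrow> v' < u'"
    using node_sym_less(1)[OF assms(1)] node_sym_less(1)[OF assms(2)] assms(3) by simp
  then show ?thesis
    using assms arc_address_inj[OF assms(1,2)] arc_address_inj[OF sym[OF assms(1)] sym[OF assms(2)]]
    unfolding node_def by (auto split: if_splits)
qed

lemma node_ne_vertex: "(u, v) \<in> E \<Longrightarrow> w < n \<Longrightarrow> node u v \<noteq> w"
  using node_bounds(1) by fastforce

text \<open>\<open>L u\<close> is the current list of the neighbours of \<open>u\<close>, for the vertices \<open>u\<close> in \<open>A\<close>.\<close>

definition neighbours_ok :: "nat set \<Rightarrow> (nat \<Rightarrow> nat list) \<Rightarrow> bool" where
  "neighbours_ok A L \<longleftrightarrow>
     A \<subseteq> {..<n} \<and> (\<forall>u\<in>A. distinct (L u) \<and> set (L u) \<subseteq> {v. (u, v) \<in> E})"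

lemma neighbours_okD:
  assumes "neighbours_ok A L" "u \<in> A"
  shows "u < n" "distinct (L u)"
    "v \<in> set (L u) \<Longrightarrow> (u, v) \<in> E \<and> (v, u) \<in> E \<and> v < n \<and> v \<noteq> u"
proof -
  show "u < n" "distinct (L u)" using assms unfolding neighbours_ok_def by auto
  assume "v \<in> set (L u)"
  then have "(u, v) \<in> E" using assms unfolding neighbours_ok_def by auto
  then show "(u, v) \<in> E \<and> (v, u) \<in> E \<and> v < n \<and> v \<noteq> u"
    using sym verts2 irrefl by metis
qed

text \<open>Each list is circular with its own vertex as sentinel. Nothing is said about vertices
  outside \<open>A\<close>: their lists keep the form they had when the vertex was decided
  on.\<close>

definition represents :: "links \<Rightarrow> nat set \<Rightarrow> (nat \<Rightarrow> nat list) \<Rightarrow> bool" where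
  "represents l A L \<longleftrightarrow> (\<forall>u\<in>A. dll l u (map (node u) (L u)) u)"

section \<open>Separation of the lists of different vertices\<close>

lemma distinct_nodes:
  assumes "neighbours_ok A L" "u \<in> A"
  shows "distinct (map (node u) (L u))" "u \<notin> set (map (node u) (L u))"
proof -
  have L: "distinct (L u)" "(u, v) \<in> E" "u < n" if "v \<in> set (L u)" for v
    using assms that unfolding neighbours_ok_def by auto
  have "inj_on (node u) (set (L u))"
    using node_inj[OF L(2) L(2)] by (auto intro: inj_onI)
  then show "distinct (map (node u) (L u))" using assms unfolding neighbours_ok_def distinct_map by auto
  show "u \<notin> set (map (node u) (L u))"
  proof
    assume "u \<in> set (map (node u) (L u))"
    then obtain v where "v \<in> set (L u)" "node u v = u" by auto
    then show False using node_ne_vertex[OF L(2) L(3)] by blast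
  qed
qed

lemma nodes_disjoint:
  assumes "neighbours_ok A L" "u \<in> A" "w \<in> A" "u \<noteq> w"
  shows "insert u (node u ` set (L u)) \<inter> insert w (node w ` set (L w)) = {}"
proof -
  have L: "(x, v) \<in> E" if "x \<in> A" "v \<in> set (L x)" for x v
    using assms(1) that unfolding neighbours_ok_def by auto
  have "u < n" "w < n" using assms unfolding neighbours_ok_def by auto
  then have "node u v \<noteq> w" if "v \<in> set (L u)" for v
    using node_ne_vertex L assms(2,3) that \<open>w < n\<close> by blast
  moreover have "node w v \<noteq> u" if "v \<in> set (L w)" for v
    using node_ne_vertex L assms(2,3) that \<open>u < n\<close> by blast
  moreover have "node u v \<noteq> node w v'" if "v \<in> set (L u)" "v' \<in> set (L w)" for v v'
    using node_inj[OF L[OF assms(2) that(1)] L[OF assms(3) that(2)]] assms(4) by blast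
  ultimately show ?thesis using assms(4) by auto
qed

lemma neighbours_ok_upd:
  assumes "neighbours_ok A L"
  shows "neighbours_ok A (L(w := removeAll v (L w)))"
  using assms unfolding neighbours_ok_def by (auto simp: distinct_removeAll)

lemma represents_cases:
  assumes ok: "neighbours_ok A L" and rep: "represents l A L" and w: "w \<in> A" and v: "v \<in> set (L w)"
  obtains xs ys where "L w = xs @ v # ys" "v \<notin> set xs" "v \<notin> set ys"
    "dll l w (map (node w) xs) (node w v)" "dll l (node w v) (map (node w) ys) w"
    "fst l (node w v) = hd (map (node w) ys @ [w])" "snd l (node w v) = last (w # map (node w) xs)"
proof -
  obtain xs ys where xy: "L w = xs @ v # ys" using split_list[OF v] by blast
  have "dll l w (map (node w) (xs @ v # ys)) w" using rep w xy unfolding represents_def by auto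
  then have d: "dll l w (map (node w) xs) (node w v)" "dll l (node w v) (map (node w) ys) w"
    by (auto simp: dll_append)
  have "distinct (L w)" using ok w unfolding neighbours_ok_def by auto
  then show thesis using that[OF xy _ _ d dll_next[OF d(2)] dll_prev[OF d(1)]] xy by auto
qed

lemma link_of_list:
  assumes ok: "neighbours_ok A L" and rep: "represents l A L" and w: "w \<in> A" and v: "v \<in> set (L w)"
  shows "fst l (node w v) \<in> insert w (node w ` set (L w))"
    and "snd l (node w v) \<in> insert w (node w ` set (L w))"
proof -
  obtain xs ys where *: "L w = xs @ v # ys" "fst l (node w v) = hd (map (node w) ys @ [w])"
     "snd l (node w v) = last (w # map (node w) xs)"
    using represents_cases[OF assms] by metis
  show "fst l (node w v) \<in> insert w (node w ` set (L w))" using * by (cases ys) auto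
  show "snd l (node w v) \<in> insert w (node w ` set (L w))"
    using * by (cases xs rule: rev_cases) auto
qed

lemma link_bounds:
  assumes ok: "neighbours_ok A L" and rep: "represents l A L" and w: "w \<in> A" and v: "v \<in> set (L w)"
  shows "fst l (node w v) < 2 * D" "snd l (node w v) < 2 * D"
proof -
  have "insert w (node w ` set (L w)) \<subseteq> {..<2 * D}"
    using ok w n_less_D node_bounds(2) unfolding neighbours_ok_def by fastforce
  then show "fst l (node w v) < 2 * D" "snd l (node w v) < 2 * D"
    using link_of_list[OF assms] by auto
qed

text \<open>The cells written belong to the list neighbours of the node, which are nodes or the
  sentinel of the list of \<open>w\<close>. Lists of other vertices are disjoint from these and
  survive by \<open>dll_cong\<close>.\<close>

lemma represents_unlink:
  assumes ok: "neighbours_ok A L" and rep: "represents l A L" and w: "w \<in> A" and v: "v \<in> set (L w)"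
  shows "represents (unlink l (node w v)) A (L(w := removeAll v (L w)))"
    and "relink (unlink l (node w v)) (node w v) = l"
proof -
  obtain xs ys where xy: "L w = xs @ v # ys" "v \<notin> set xs" "v \<notin> set ys"
    using represents_cases[OF assms] by metis
  have d: "dll l w (map (node w) xs @ node w v # map (node w) ys) w"
    using rep w xy unfolding represents_def by auto
  have dist: "distinct (map (node w) xs @ node w v # map (node w) ys)"
    "w \<notin> set (map (node w) xs @ node w v # map (node w) ys)"
    using distinct_nodes[OF ok w] unfolding xy(1) by auto
  show "relink (unlink l (node w v)) (node w v) = l"
    using relink_unlink[OF d] dist by auto
  show "represents (unlink l (node w v)) A (L(w := removeAll v (L w)))"
    unfolding represents_def
  proof
    fix u assume u: "u \<in> A"
    show "dll (unlink l (node w v)) u (map (node u) ((L(w := removeAll v (L w))) u)) u"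
    proof (cases "u = w")
      case True
      have "dll (unlink l (node w v)) w (map (node w) xs @ map (node w) ys) w"
        using dll_unlink[OF d] dist by simp
      then show ?thesis using True xy by simp
    next
      case False
      obtain nx pv where l: "l = (nx, pv)" by (cases l)
      have "pv (node w v) \<notin> insert u (node u ` set (L u))"
        and "nx (node w v) \<notin> insert u (node u ` set (L u))"
        using link_of_list[OF assms] nodes_disjoint[OF ok u w False] unfolding l by auto
      then have "dll (unlink l (node w v)) u (map (node u) (L u)) u
          \<longleftrightarrow> dll l u (map (node u) (L u)) u"
        unfolding l by (intro dll_cong) auto
      then show ?thesis using False rep u unfolding represents_def by simp
    qed
  qed
qed

text \<open>This is what lets the backtracking code read the links of a node after it has been
  unlinked.\<close>

lemma unlink_self:
  assumes ok: "neighbours_ok A L" and rep: "represents l A L" and w: "w \<in> A" and v: "v \<in> set (L w)"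
  shows "fst (unlink l (node w v)) (node w v) = fst l (node w v)"
    and "snd (unlink l (node w v)) (node w v) = snd l (node w v)"
proof -
  obtain nx pv where l: "l = (nx, pv)" by (cases l)
  obtain xs ys where *: "L w = xs @ v # ys" "fst l (node w v) = hd (map (node w) ys @ [w])"
     "snd l (node w v) = last (w # map (node w) xs)"
    using represents_cases[OF assms] by metis
  have d: "distinct (map (node w) xs @ node w v # map (node w) ys)"
    "w \<notin> set (map (node w) xs @ node w v # map (node w) ys)"
    using distinct_nodes[OF ok w] unfolding *(1) by auto
  have "hd (map (node w) ys @ [w]) \<noteq> node w v" using d by (cases ys) auto
  moreover have "last (w # map (node w) xs) \<noteq> node w v" using d by (cases xs rule: rev_cases) auto
  ultimately show "fst (unlink l (node w v)) (node w v) = fst l (node w v)"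
    and "snd (unlink l (node w v)) (node w v) = snd l (node w v)"
    using *(2,3) l by auto
qed

lemma represents_link_after:
  assumes ok: "neighbours_ok A L" and rep: "represents l A L" and w: "w \<in> A"
    and v: "v \<notin> set (L w)" "(w, v) \<in> E"
  shows "represents (link_after l w (node w v)) A (L(w := v # L w))"
  unfolding represents_def
proof
  fix u assume u: "u \<in> A"
  have sub: "set (L x) \<subseteq> {v. (x, v) \<in> E}" "x < n" if "x \<in> A" for x
    using ok that unfolding neighbours_ok_def by auto
  have d: "dll l x (map (node x) (L x)) x" if "x \<in> A" for x
    using rep that unfolding represents_def by auto
  have fresh: "node w v \<noteq> node x z" if "x \<in> A" "z \<in> set (L x)" for x z
    using node_inj[OF v(2), of x z] sub that v(1) by auto
  show "dll (link_after l w (node w v)) u (map (node u) ((L(w := v # L w)) u)) u"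
  proof (cases "u = w")
    case True
    have "node w v \<noteq> w" using node_ne_vertex[OF v(2) sub(2)[OF w]] .
    moreover have "node w v \<notin> set (map (node w) (L w))" using fresh[OF w] by auto
    ultimately have "dll (link_after l w (node w v)) w (node w v # map (node w) (L w)) w"
      using distinct_nodes[OF ok w] by (intro dll_link_after d w) auto
    then show ?thesis using True by simp
  next
    case False
    obtain nx pv where l: "l = (nx, pv)" by (cases l)
    have "nx w \<in> insert w (node w ` set (L w))"
      using dll_next[OF d[OF w]] l by (cases "L w") auto
    then have "nx w \<notin> insert u (node u ` set (L u))" "w \<notin> insert u (node u ` set (L u))"
      using nodes_disjoint[OF ok u w False] by auto
    moreover have "node w v \<notin> insert u (node u ` set (L u))"
      using fresh[OF u] node_ne_vertex[OF v(2) sub(2)[OF u]] by auto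
    ultimately have "z \<noteq> nx w" "z \<noteq> w" "z \<noteq> node w v" if "z \<in> insert u (node u ` set (L u))" for z
      using that by blast+
    then have "dll (link_after l w (node w v)) u (map (node u) (L u)) u
        \<longleftrightarrow> dll l u (map (node u) (L u)) u"
      unfolding l by (intro dll_cong) simp_all
    then show ?thesis using False d[OF u] by simp
  qed
qed

abbreviation unlink_from :: "links \<Rightarrow> nat \<Rightarrow> nat list \<Rightarrow> links" where
  "unlink_from l v ws \<equiv> foldl unlink l (map (\<lambda>w. node w v) ws)"

lemma neighbours_ok_unlink_from:
  assumes "neighbours_ok A L"
  shows "neighbours_ok A (\<lambda>u. if u \<in> set ws then removeAll v (L u) else L u)"
  using assms unfolding neighbours_ok_def by (auto simp: distinct_removeAll)

lemma represents_unlink_from: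
  assumes "neighbours_ok A L" "represents l A L" "distinct ws" "set ws \<subseteq> A"
    and "\<And>w. w \<in> set ws \<Longrightarrow> v \<in> set (L w)"
  shows "represents (unlink_from l v ws) A (\<lambda>u. if u \<in> set ws then removeAll v (L u) else L u)"
  using assms
proof (induction ws arbitrary: l L)
  case Nil
  then show ?case by simp
next
  case (Cons w ws)
  let ?L = "L(w := removeAll v (L w))"
  have "represents (unlink_from (unlink l (node w v)) v ws) A
      (\<lambda>u. if u \<in> set ws then removeAll v (?L u) else ?L u)"
  proof (rule Cons.IH)
    show "neighbours_ok A ?L" by (rule neighbours_ok_upd) (rule Cons.prems)
    show "represents (unlink l (node w v)) A ?L"
      using Cons.prems by (intro represents_unlink(1)) auto
  qed (use Cons.prems in auto)
  moreover have "(\<lambda>u. if u \<in> set ws then removeAll v (?L u) else ?L u)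
    = (\<lambda>u. if u \<in> set (w # ws) then removeAll v (L u) else L u)"
    using Cons.prems(3) by auto
  ultimately show ?case by simp
qed

end

section \<open>The program\<close>

abbreviation (input) zeroR :: reg where "zeroR \<equiv> 0"
abbreviation (input) oneR :: reg where "oneR \<equiv> 1"
abbreviation (input) nR :: reg where "nR \<equiv> 2"
abbreviation (input) DR :: reg where "DR \<equiv> 3"
abbreviation (input) nextR :: reg where "nextR \<equiv> 4"
abbreviation (input) prevR :: reg where "prevR \<equiv> 5"
abbreviation (input) queueR :: reg where "queueR \<equiv> 6"
abbreviation (input) lengthR :: reg where "lengthR \<equiv> 7"
abbreviation (input) positionR :: reg where "positionR \<equiv> 8"
abbreviation (input) rootR :: reg where "rootR \<equiv> 9"
abbreviation (input) hR :: reg where "hR \<equiv> 10"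
abbreviation (input) tR :: reg where "tR \<equiv> 11"
abbreviation (input) modeR :: reg where "modeR \<equiv> 12"
abbreviation (input) vR :: reg where "vR \<equiv> 13"
abbreviation (input) xR :: reg where "xR \<equiv> 14"
abbreviation (input) yR :: reg where "yR \<equiv> 15"
abbreviation (input) pR :: reg where "pR \<equiv> 16"
abbreviation (input) qR :: reg where "qR \<equiv> 17"
abbreviation (input) aR :: reg where "aR \<equiv> 18"
abbreviation (input) wR :: reg where "wR \<equiv> 19"
abbreviation (input) iR :: reg where "iR \<equiv> 20"
abbreviation (input) endR :: reg where "endR \<equiv> 21"
abbreviation (input) oldR :: reg where "oldR \<equiv> 22"

abbreviation seq :: "com \<Rightarrow> com \<Rightarrow> com" (infixr \<open>;;\<close> 60) where
  "p ;; p' \<equiv> Seq p p'"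

definition get :: "reg \<Rightarrow> reg \<Rightarrow> reg \<Rightarrow> com" where
  "get r b i = Add aR b i ;; Load r aR"

definition put :: "reg \<Rightarrow> reg \<Rightarrow> reg \<Rightarrow> com" where
  "put b i r = Add aR b i ;; Store aR r"

definition unlink_com :: com where
  "unlink_com = get pR prevR yR ;; get qR nextR yR ;; put nextR pR qR ;; put prevR qR pR"

definition relink_com :: com where
  "relink_com = get pR prevR yR ;; get qR nextR yR ;; put nextR pR yR ;; put prevR qR yR"

definition twin_com :: com where
  "twin_com = If (Less xR DR) (Add yR xR DR) (Sub yR xR DR)"

definition push_com :: com where
  "push_com = put queueR tR wR ;; put positionR wR tR ;; Add tR tR oneR"

text \<open>
  A vertex \<open>w\<close> is in the queue iff its recorded position is one of the positions in use and
  holds \<open>w\<close>.  Hence backtracking shortens the queue without erasing any marks.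
\<close>

definition push_new_com :: com where
  "push_new_com = get pR positionR wR ;;
     If (Less pR tR) (get qR queueR pR ;; If (Equal qR wR) Skip push_com) push_com"

text \<open>List nodes have addresses of at least \<open>n\<close>, while the list of
  \<open>v\<close> closes with the sentinel \<open>v < n\<close>. The test therefore fails exactly
  when the traversal has come full circle.\<close>

definition scan_com :: com where
  "scan_com = While (Less vR xR)
     (twin_com ;; unlink_com ;; Load wR xR ;; push_new_com ;; get xR nextR xR)"

definition unscan_com :: com where
  "unscan_com = While (Less vR xR) (twin_com ;; relink_com ;; get xR prevR xR)"

definition include_com :: com where
  "include_com = get vR queueR hR ;; EmitIns vR ;; Add oldR tR zeroR ;; get xR nextR vR ;;
     scan_com ;; put lengthR hR oldR ;; Add hR hR oneR"

text \<open>
  The length of the queue before the inclusion of a vertex is positive, so \<open>0\<close> can mark the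
  vertices that are excluded.
\<close>

definition back_com :: com where
  "back_com = Sub hR hR oneR ;; get vR queueR hR ;; get iR lengthR hR ;;
     If (Equal iR zeroR)
       (get xR prevR vR ;; unscan_com)
       (EmitDel vR ;; Add tR iR zeroR ;; put lengthR hR zeroR ;; Add hR hR oneR ;; Const modeR 1)"

text \<open>Mode 1 descends and mode 0 backtracks. The first \<open>hR\<close> queue entries act as
  the stack of decisions, so the search ends once the decision on the root at position 0 is
  popped.\<close>

definition search_com :: com where
  "search_com = While (Less zeroR hR)
     (If (Equal modeR oneR)
       (If (Less hR tR) include_com (EmitRep ;; Const modeR 0))
       back_com)"

section \<open>Correctness of the search\<close>

locale machine = adjacency +
  fixes W S :: nat
  assumes W: "9 * D < W" and S: "9 * D \<le> S"
begin

text \<open>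
  The memory consists of nine blocks of length \<open>D\<close>, the length of the input: blocks 0 and 1 hold
  the target vertices of the list nodes, blocks 2 and 3 their successors, blocks 4 and 5 their
  predecessors, block 6 the queue, block 7 its length before each decision, and block 8 the
  position of each vertex in the queue.
\<close>

definition const_regs :: "(reg \<Rightarrow> nat) \<Rightarrow> bool" where
  "const_regs R \<longleftrightarrow> R zeroR = 0 \<and> R oneR = 1 \<and> R nR = n \<and> R DR = D \<and> R nextR = 2 * D \<and>
     R prevR = 4 * D \<and> R queueR = 6 * D \<and> R lengthR = 7 * D \<and> R positionR = 8 * D"

definition bounded :: "(nat \<Rightarrow> nat) \<Rightarrow> bool" where
  "bounded M \<longleftrightarrow> (\<forall>a. M a < W)"

text \<open>The default 0 outside the link blocks makes \<open>links_of\<close> depend on nothing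
  but these blocks, so exact restoration of all lists can be stated as an equation between
  functions.\<close>

definition links_of :: "(nat \<Rightarrow> nat) \<Rightarrow> links" where
  "links_of M = (\<lambda>z. if z < 2 * D then M (2 * D + z) else 0, \<lambda>z. if z < 2 * D then M (4 * D + z) else 0)"

definition queue :: "(nat \<Rightarrow> nat) \<Rightarrow> nat list \<Rightarrow> bool" where
  "queue M qs \<longleftrightarrow> (\<forall>i < length qs. M (6 * D + i) = qs ! i \<and> M (8 * D + qs ! i) = i)"

lemma const_regsD:
  assumes "const_regs R"
  shows "R zeroR = 0" "R (Suc 0) = Suc 0" "R nR = n" "R DR = D" "R nextR = 2 * D" "R prevR = 4 * D"
    "R queueR = 6 * D" "R lengthR = 7 * D" "R positionR = 8 * D"
  using assms unfolding const_regs_def by auto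

lemma const_regs_upd [simp]: "9 \<le> r \<Longrightarrow> const_regs (R(r := x)) \<longleftrightarrow> const_regs R"
  unfolding const_regs_def by simp

lemma const_regs_cong: "const_regs R \<Longrightarrow> (\<And>r. r < 9 \<Longrightarrow> R' r = R r) \<Longrightarrow> const_regs R'"
  unfolding const_regs_def by simp

lemma boundedD: "bounded M \<Longrightarrow> M a < W"
  unfolding bounded_def by simp

lemma bounded_upd: "bounded M \<Longrightarrow> x < W \<Longrightarrow> bounded (M(a := x))"
  unfolding bounded_def by simp

lemma fst_links_of: "z < 2 * D \<Longrightarrow> fst (links_of M) z = M (2 * D + z)"
  and snd_links_of: "z < 2 * D \<Longrightarrow> snd (links_of M) z = M (4 * D + z)"
  unfolding links_of_def by auto

lemma links_of_upd:
  "a < 2 * D \<or> 6 * D \<le> a \<Longrightarrow> links_of (M(a := x)) = links_of M"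
  "p < 2 * D \<Longrightarrow> links_of (M(2 * D + p := x)) = ((fst (links_of M))(p := x), snd (links_of M))"
  "p < 2 * D \<Longrightarrow> links_of (M(4 * D + p := x)) = (fst (links_of M), (snd (links_of M))(p := x))"
  unfolding links_of_def by auto

section \<open>List operations on the memory\<close>

lemma unlink_com:
  assumes R: "const_regs R" and M: "bounded M" and y: "R yR < 2 * D"
    and p: "snd (links_of M) (R yR) < 2 * D" and q: "fst (links_of M) (R yR) < 2 * D"
  shows "wp W S unlink_com (\<lambda>tm out (R', M'). tm = 8 \<and> out = [] \<and>
     (\<forall>r. r \<notin> {pR, qR, aR} \<longrightarrow> R' r = R r) \<and> bounded M' \<and>
     links_of M' = unlink (links_of M) (R yR) \<and> (\<forall>a. a < 2 * D \<or> 6 * D \<le> a \<longrightarrow> M' a = M a)) (R, M)"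
proof -
  obtain nx pv where l: "links_of M = (nx, pv)" by (cases "links_of M")
  then have "nx (R yR) = M (2 * D + R yR)" "pv (R yR) = M (4 * D + R yR)"
    using fst_links_of[OF y, of M] snd_links_of[OF y, of M] by auto
  then show ?thesis
    using W S y p q boundedD[OF M]
    by (simp add: l unlink_com_def get_def put_def const_regsD[OF R] links_of_upd
        bounded_upd[OF bounded_upd] M)
qed

lemma relink_com:
  assumes R: "const_regs R" and M: "bounded M" and y: "R yR < 2 * D"
    and p: "snd (links_of M) (R yR) < 2 * D" and q: "fst (links_of M) (R yR) < 2 * D"
  shows "wp W S relink_com (\<lambda>tm out (R', M'). tm = 8 \<and> out = [] \<and>
     (\<forall>r. r \<notin> {pR, qR, aR} \<longrightarrow> R' r = R r) \<and> bounded M' \<and>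
     links_of M' = relink (links_of M) (R yR) \<and> (\<forall>a. a < 2 * D \<or> 6 * D \<le> a \<longrightarrow> M' a = M a)) (R, M)"
proof -
  obtain nx pv where l: "links_of M = (nx, pv)" by (cases "links_of M")
  then have "nx (R yR) = M (2 * D + R yR)" "pv (R yR) = M (4 * D + R yR)"
    using fst_links_of[OF y, of M] snd_links_of[OF y, of M] by auto
  then show ?thesis
    using W S y p q boundedD[OF M]
    by (simp add: l relink_com_def get_def put_def const_regsD[OF R] links_of_upd
        bounded_upd[OF bounded_upd] M)
qed

lemma twin_com:
  assumes R: "const_regs R" and x: "R xR = node u v" and E: "(u, v) \<in> E"
  shows "wp W S twin_com (\<lambda>tm out (R', M'). tm = 2 \<and> out = [] \<and>
     R' = R(yR := node v u) \<and> M' = M) (R, M)"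
  using W node_twin[OF E] node_bounds(2)[OF E] x
  by (auto simp: twin_com_def const_regsD[OF R])

section \<open>The queue and its membership test\<close>

definition enqueue :: "nat list \<Rightarrow> nat \<Rightarrow> nat list" where
  "enqueue qs w = (if w \<in> set qs then qs else qs @ [w])"

text \<open>The sparse-set test: a stale or never written position is refuted by the queue cell to
  which it points.\<close>

lemma queue_mem:
  assumes "queue M qs"
  shows "w \<in> set qs \<longleftrightarrow> M (8 * D + w) < length qs \<and> M (6 * D + M (8 * D + w)) = w"
  using assms unfolding queue_def by (metis in_set_conv_nth)

lemma queue_length:
  assumes "distinct qs" "set qs \<subseteq> {..<n}"
  shows "length qs \<le> n"
  using assms by (metis card_lessThan card_mono distinct_card finite_lessThan)

lemma queue_push:
  assumes "queue M qs" "set qs \<subseteq> {..<n}" "w < n" "w \<notin> set qs" "length qs < n"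
  shows "queue (M(6 * D + length qs := w, 8 * D + w := length qs)) (qs @ [w])"
proof -
  have "qs ! i \<noteq> w" "qs ! i < n" if "i < length qs" for i using assms that nth_mem by auto
  then show ?thesis
    using assms n_less_D unfolding queue_def by (fastforce simp: nth_append less_Suc_eq)
qed

lemma queue_cong: "queue M qs \<Longrightarrow> (\<And>a. 6 * D \<le> a \<Longrightarrow> M' a = M a) \<Longrightarrow> queue M' qs"
  unfolding queue_def by simp

lemma queue_upd_length:
  assumes "queue M qs" "length qs \<le> n" "h < D"
  shows "queue (M(7 * D + h := x)) qs"
  using assms n_less_D unfolding queue_def by simp

lemma push_com:
  assumes R: "const_regs R" and M: "bounded M" and q: "queue M qs" "distinct qs" "set qs \<subseteq> {..<n}"
    and t: "R tR = length qs" and w: "R wR = w" "w < n" "w \<notin> set qs"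
  shows "wp W S push_com (\<lambda>tm out (R', M'). tm = 5 \<and> out = [] \<and>
     (\<forall>r. r \<notin> {tR, aR} \<longrightarrow> R' r = R r) \<and> bounded M' \<and> R' tR = Suc (length qs) \<and>
     queue M' (qs @ [w]) \<and> links_of M' = links_of M \<and> (\<forall>a < 2 * D. M' a = M a) \<and>
     (\<forall>i < D. M' (7 * D + i) = M (7 * D + i))) (R, M)"
proof -
  have "length (qs @ [w]) \<le> n" using q w by (intro queue_length) auto
  then have len: "length qs < n" by simp
  show ?thesis
    using W S t w len n_less_D queue_push[OF q(1,3) w(2,3) len]
    by (simp add: push_com_def put_def const_regsD[OF R] links_of_upd bounded_upd[OF bounded_upd] M)
qed

lemma push_new_com:
  assumes R: "const_regs R" and M: "bounded M" and q: "queue M qs" "distinct qs" "set qs \<subseteq> {..<n}"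
    and t: "R tR = length qs" and w: "R wR = w" "w < n"
  shows "wp W S push_new_com (\<lambda>tm out (R', M'). tm \<le> 11 \<and> out = [] \<and>
     (\<forall>r. r \<notin> {tR, aR, pR, qR} \<longrightarrow> R' r = R r) \<and> bounded M' \<and>
     R' tR = length (enqueue qs w) \<and> queue M' (enqueue qs w) \<and>
     links_of M' = links_of M \<and> (\<forall>a < 2 * D. M' a = M a) \<and>
     (\<forall>i < D. M' (7 * D + i) = M (7 * D + i))) (R, M)"
proof (cases "M (8 * D + w) < length qs")
  case True
  have len: "length qs \<le> n" using q by (intro queue_length)
  show ?thesis
    using True W S w n_less_D len t boundedD[OF M] queue_mem[OF q(1), of w] q R
    by (auto simp: enqueue_def push_new_com_def get_def const_regsD[OF R] M intro!: wp_mono[OF push_com[OF _ M q]])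
next
  case False
  then have "w \<notin> set qs" using queue_mem[OF q(1)] by simp
  then show ?thesis
    using False W S w n_less_D t boundedD[OF M] R
    by (auto simp: enqueue_def push_new_com_def get_def const_regsD[OF R] intro!: wp_mono[OF push_com[OF _ M q]])
qed

text \<open>The step removes \<open>v\<close> from the list of \<open>w\<close>, not
  \<open>w\<close> from the list of \<open>v\<close>. Hence the successor that is read afterwards is
  still the one in the unchanged list of \<open>v\<close>. The bound 24 is 2 + 8 + 1 + 11 +
  2.\<close>

lemma scan_step:
  assumes R: "const_regs R" and M: "bounded M"
    and L: "neighbours_ok A L" "represents (links_of M) A L" and v: "v \<in> A" "R vR = v"
    and us: "L v = us @ w # ws" and x: "R xR = node v w"
    and w: "w \<in> A" "v \<in> set (L w)" "M (node v w) = w"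
    and q: "queue M qs" "distinct qs" "set qs \<subseteq> {..<n}" and t: "R tR = length qs"
  shows "wp W S (twin_com ;; unlink_com ;; Load wR xR ;; push_new_com ;; get xR nextR xR)
    (\<lambda>tm out (R', M'). tm \<le> 24 \<and> out = [] \<and>
     (\<forall>r. r \<notin> {tR, xR, yR, pR, qR, aR, wR} \<longrightarrow> R' r = R r) \<and> bounded M' \<and>
     R' xR = hd (map (node v) ws @ [v]) \<and>
     R' tR = length (enqueue qs w) \<and> queue M' (enqueue qs w) \<and>
     links_of M' = unlink (links_of M) (node w v) \<and> (\<forall>a < 2 * D. M' a = M a) \<and>
     (\<forall>i < D. M' (7 * D + i) = M (7 * D + i))) (R, M)"
proof -
  have E: "(v, w) \<in> E" "w < n" "v < n" "w \<noteq> v" "(w, v) \<in> E"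
    using neighbours_okD[OF L(1) w(1)] neighbours_okD[OF L(1) v(1)] w(2) us by auto
  note lb = link_bounds[OF L w(1,2)]
  let ?l = "unlink (links_of M) (node w v)"
  have "represents ?l A (L(w := removeAll v (L w)))" by (rule represents_unlink[OF L w(1,2)])
  then have "dll ?l v (map (node v) (us @ w # ws)) v"
    using v E us unfolding represents_def by auto
  then have nx: "fst ?l (node v w) = hd (map (node v) ws @ [v])"
    using dll_next by (simp add: dll_append)
  show ?thesis
    unfolding wp_Seq
    apply (rule wp_mono[OF twin_com[OF R x E(1)]])
    apply (clarsimp)
    apply (rule wp_mono[OF unlink_com])
        apply (use R M lb node_bounds[OF E(5)] in simp_all)[5]
    apply clarsimp
    subgoal for R1 M1
      using node_bounds(2)[OF E(1)] W S n_less_D E(2) w(3) R q t x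
      apply (simp add: boundedD)
      apply (rule wp_mono[OF push_new_com[where qs = qs and w = w]])
             apply (simp_all add: const_regs_cong[of R] queue_cong[of M])[8]
      apply clarsimp
      subgoal for tm R2 M2
        using nx const_regsD(5)[of R] fst_links_of[of "node v w" M2]
        apply (simp add: get_def boundedD)
        done
      done
    done
qed

lemma scan_com:
  assumes "const_regs R" "bounded M" "neighbours_ok A L" "represents (links_of M) A L"
    and "v \<in> A" "R vR = v" "L v = us @ ws" "R xR = hd (map (node v) ws @ [v])"
    and "\<And>w. w \<in> set ws \<Longrightarrow> w \<in> A \<and> v \<in> set (L w) \<and> M (node v w) = w"
    and "queue M qs" "distinct qs" "set qs \<subseteq> {..<n}" "R tR = length qs"
  shows "wp W S scan_com (\<lambda>tm out (R', M'). tm \<le> 1 + 25 * length ws \<and> out = [] \<and>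
     (\<forall>r. r \<notin> {tR, xR, yR, pR, qR, aR, wR} \<longrightarrow> R' r = R r) \<and> bounded M' \<and>
     R' tR = length (qs @ filter (\<lambda>w. w \<notin> set qs) ws) \<and>
     queue M' (qs @ filter (\<lambda>w. w \<notin> set qs) ws) \<and>
     links_of M' = unlink_from (links_of M) v ws \<and> (\<forall>a < 2 * D. M' a = M a) \<and>
     (\<forall>i < D. M' (7 * D + i) = M (7 * D + i))) (R, M)"
  using assms
proof (induction ws arbitrary: R M L us qs)
  case Nil
  then show ?case unfolding scan_com_def by (subst wp_While) simp
next
  case (Cons w ws)
  note prems = Cons.prems
  have w: "w \<in> A" "v \<in> set (L w)" "M (node v w) = w" using prems(9) by auto
  have E: "(v, w) \<in> E" "w < n" "v < n" "w \<noteq> v" "(w, v) \<in> E"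
    using neighbours_okD[OF prems(3) w(1)] neighbours_okD[OF prems(3,5)] w(2) by auto
  have dist: "w \<notin> set ws" using neighbours_okD(2)[OF prems(3,5)] prems(7) by simp
  have x: "R xR = node v w" using prems(8) by simp
  have "v < node v w" using node_bounds(1)[OF E(1)] E(3) by simp
  let ?L = "L(w := removeAll v (L w))"
  \<comment> \<open>Enqueuing one by one agrees with filtering against the old queue, because
    \<open>w\<close> does not recur in \<open>ws\<close>.\<close>
  have filter_enq: "qs @ filter (\<lambda>w. w \<notin> set qs) (w # ws)
      = enqueue qs w @ filter (\<lambda>w'. w' \<notin> set (enqueue qs w)) ws"
    using dist unfolding enqueue_def by (auto intro: filter_cong)
  have ok': "neighbours_ok A ?L" by (rule neighbours_ok_upd[OF prems(3)])
  have rep': "represents (unlink (links_of M) (node w v)) A ?L"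
    by (rule represents_unlink(1)[OF prems(3,4) w(1,2)])
  note step = scan_step[OF prems(1-6) prems(7) x w prems(10-13)]
  show ?case
    unfolding scan_com_def
    apply (rule wp_While_step)
    using \<open>v < node v w\<close> prems(6) x apply simp
    apply (rule wp_mono[OF step])
    apply (fold scan_com_def)
    apply clarify
    subgoal premises p for tm _ R1 M1
    proof (rule wp_mono[OF Cons.IH[of R1 M1 ?L "us @ [w]" "enqueue qs w"]])
      show "const_regs R1" using p prems(1) by (simp add: const_regs_cong[of R])
      show "represents (links_of M1) A ?L" using p rep' by simp
      show "w' \<in> A \<and> v \<in> set (?L w') \<and> M1 (node v w') = w'" if "w' \<in> set ws" for w'
      proof -
        have "(v, w') \<in> E" using neighbours_okD(3)[OF prems(3,5)] prems(7) that by simp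
        then have "M1 (node v w') = M (node v w')" using p node_bounds(2) by simp
        then show ?thesis using prems(9)[of w'] that dist by auto
      qed
      show "distinct (enqueue qs w)" "set (enqueue qs w) \<subseteq> {..<n}"
        using prems(11,12) E unfolding enqueue_def by auto
    qed (use p prems ok' E filter_enq in \<open>simp_all del: fun_upd_apply, (clarsimp simp del: filter.simps)?\<close>)
    done
qed

text \<open>The list of \<open>v\<close> is traversed backwards, so the node unlinked last is
  relinked first. Each relinking then meets the very links that its unlinking produced, which is why
  the induction peels off the last element.\<close>

lemma unscan_com:
  assumes "const_regs R" "bounded M" "neighbours_ok A L" "represents l A L"
    and "v \<in> A" "R vR = v" "L v = us @ vs" "R xR = last (v # map (node v) us)"
    and "\<And>w. w \<in> set us \<Longrightarrow> w \<in> A \<and> v \<in> set (L w)"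
    and "links_of M = unlink_from l v us"
  shows "wp W S unscan_com (\<lambda>tm out (R', M'). tm \<le> 1 + 15 * length us \<and> out = [] \<and>
     (\<forall>r. r \<notin> {xR, yR, pR, qR, aR} \<longrightarrow> R' r = R r) \<and> bounded M' \<and>
     links_of M' = l \<and> (\<forall>a. a < 2 * D \<or> 6 * D \<le> a \<longrightarrow> M' a = M a)) (R, M)"
  using assms
proof (induction us arbitrary: R M vs rule: rev_induct)
  case Nil
  then show ?case unfolding unscan_com_def by (subst wp_While) simp
next
  case (snoc w us)
  note prems = snoc.prems
  let ?l = "unlink_from l v us"
  let ?L = "\<lambda>u. if u \<in> set us then removeAll v (L u) else L u"
  have d: "distinct (us @ w # vs)" using neighbours_okD(2)[OF prems(3,5)] prems(7) by simp
  have w: "w \<in> A" "v \<in> set (L w)" using prems(9) by auto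
  have E: "(v, w) \<in> E" "v < n" "w \<noteq> v" "(w, v) \<in> E"
    using neighbours_okD[OF prems(3) w(1)] neighbours_okD[OF prems(3,5)] w(2) by auto
  have vus: "v \<notin> set us" using neighbours_okD(3)[OF prems(3,5)] prems(7) by auto
  have x: "R xR = node v w" using prems(8) by simp
  have "v < node v w" using node_bounds(1)[OF E(1)] E(2) by simp
  have L: "neighbours_ok A ?L" "represents ?l A ?L"
    using prems d by (auto intro: neighbours_ok_unlink_from represents_unlink_from)
  have w': "v \<in> set (?L w)" using w d by auto
  have lM: "links_of M = unlink ?l (node w v)" using prems(10) by simp
  note rel = represents_unlink(2)[OF L w(1) w'] and self = unlink_self[OF L w(1) w']
    and lb = link_bounds[OF L w(1) w']
  have "dll ?l v (map (node v) (us @ w # vs)) v"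
    using L(2) prems(5,7) vus unfolding represents_def by auto
  then have pv: "snd ?l (node v w) = last (v # map (node v) us)"
    using dll_prev[of ?l v "map (node v) us" "node v w"] by (simp add: dll_append)
  show ?case
    unfolding unscan_com_def
    apply (rule wp_While_step)
    using \<open>v < node v w\<close> prems(6) x apply simp
    apply (fold unscan_com_def)
    unfolding wp_Seq
    apply (rule wp_mono[OF twin_com[OF prems(1) x E(1)]])
    apply clarify
    apply (rule wp_mono[OF relink_com])
         apply (use prems(1,2) lM self lb node_bounds[OF E(4)] in simp_all)[5]
    apply clarsimp
    subgoal for R1 M1
      using pv const_regsD(6)[OF prems(1)] snd_links_of[of "node v w" M1] node_bounds(2)[OF E(1)] W S x
      apply (simp add: get_def boundedD lM rel)
      apply (rule wp_mono[OF snoc.IH[where vs = "w # vs"]])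
                apply (use prems w in \<open>simp_all add: const_regs_cong[of R]\<close>)
      done
    done
qed

text \<open>\<open>L\<close> stays fixed during one search, so the lists expected in memory are
  determined by \<open>A\<close>; a decision and its reversal amount to changing
  \<open>A\<close>.\<close>

definition remaining :: "nat set \<Rightarrow> (nat \<Rightarrow> nat list) \<Rightarrow> nat \<Rightarrow> nat list" where
  "remaining A L u = filter (\<lambda>w. w \<in> A) (L u)"

definition complete :: "nat set \<Rightarrow> (nat \<Rightarrow> nat list) \<Rightarrow> bool" where
  "complete A L \<longleftrightarrow> A \<subseteq> {..<n} \<and>
     (\<forall>u\<in>A. distinct (L u) \<and> set (remaining A L u) = {w \<in> A. (u, w) \<in> E})"

lemma complete_mono: "complete A L \<Longrightarrow> B \<subseteq> A \<Longrightarrow> complete B L"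
  unfolding complete_def remaining_def by (auto 0 4)

lemma complete_ok: "complete A L \<Longrightarrow> neighbours_ok A (remaining A L)"
  unfolding complete_def neighbours_ok_def by (auto simp: remaining_def)

lemma complete_set: "complete A L \<Longrightarrow> u \<in> A \<Longrightarrow> set (remaining A L u) = {w \<in> A. (u, w) \<in> E}"
  unfolding complete_def by blast

text \<open>Deleting \<open>v\<close> from the lists of its own neighbours is enough: by symmetry of
  the arcs, no other list contains it.\<close>

lemma remaining_remove:
  assumes "complete A L" "v \<in> A" "u \<in> A - {v}"
  shows "(if u \<in> set (remaining A L v) then removeAll v (remaining A L u) else remaining A L u)
    = remaining (A - {v}) L u"
proof -
  have "removeAll v (remaining A L u) = remaining (A - {v}) L u"
    unfolding remaining_def removeAll_filter_not_eq filter_filter by (intro filter_cong) auto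
  moreover have "removeAll v (remaining A L u) = remaining A L u" if "u \<notin> set (remaining A L v)"
  proof -
    have "v \<notin> set (remaining A L u)"
      using that assms sym by (auto simp: complete_set)
    then show ?thesis by simp
  qed
  ultimately show ?thesis by simp
qed

text \<open>The state at a loop head in descending mode. Entries before \<open>h\<close> are
  decided, those from \<open>h\<close> on form the queue \<open>F\<close> of the search tree;
  \<open>A\<close> is a separate parameter because it also contains undecided vertices that have not
  been queued.\<close>

definition config :: "(reg \<Rightarrow> nat) \<Rightarrow> (nat \<Rightarrow> nat) \<Rightarrow> nat set \<Rightarrow> (nat \<Rightarrow> nat list) \<Rightarrow> nat \<Rightarrow> nat list \<Rightarrow> bool" where
  "config R M A L h qs \<longleftrightarrow>
     const_regs R \<and> bounded M \<and> R hR = h \<and> R tR = length qs \<and>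
     distinct qs \<and> set qs \<subseteq> {..<n} \<and> queue M qs \<and>
     A \<inter> set (take h qs) = {} \<and> set (drop h qs) \<subseteq> A \<and>
     complete A L \<and> represents (links_of M) A (remaining A L) \<and>
     (\<forall>u\<in>A. \<forall>w\<in>A. (u, w) \<in> E \<longrightarrow> M (node u w) = w)"

lemma include_com:
  assumes c: "config R M A L h qs" and h: "h < length qs"
  defines "v \<equiv> qs ! h"
  defines "ws \<equiv> remaining A L v"
  defines "qs' \<equiv> qs @ filter (\<lambda>w. w \<notin> set qs) ws"
  shows "wp W S include_com (\<lambda>tm out (R', M'). tm \<le> 10 + 25 * length ws \<and> out = [Ins v] \<and>
     (\<forall>r. r < 10 \<or> r = modeR \<longrightarrow> R' r = R r) \<and> config R' M' (A - {v}) L (Suc h) qs' \<and>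
     links_of M' = unlink_from (links_of M) v ws \<and> (\<forall>a < 2 * D. M' a = M a) \<and>
     M' (7 * D + h) = length qs \<and> (\<forall>i < D. i \<noteq> h \<longrightarrow> M' (7 * D + i) = M (7 * D + i))) (R, M)"
proof -
  note c' = c[unfolded config_def]
  have R: "const_regs R" and M: "bounded M" and RhR: "R hR = h" and t: "R tR = length qs"
    and qs: "queue M qs" "distinct qs" "set qs \<subseteq> {..<n}" and L: "complete A L"
    and rep: "represents (links_of M) A (remaining A L)"
    using c' by auto
  have len: "length qs \<le> n" using qs by (intro queue_length)
  have v: "v \<in> A" using c' h unfolding v_def by (metis Cons_nth_drop_Suc list.set_intros(1) subsetD)
  have vn: "v < n" using v L unfolding complete_def by auto
  have Mv: "M (6 * D + h) = v" using qs h unfolding queue_def v_def by auto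
  have x: "M (2 * D + v) = hd (map (node v) ws @ [v])"
    using dll_next[of "links_of M" v] rep v vn n_less_D fst_links_of[of v M]
    unfolding represents_def ws_def by auto
  have xW: "hd (map (node v) ws @ [v]) < W" using boundedD[OF M] unfolding x[symmetric] .
  have ws: "w \<in> A \<and> v \<in> set (remaining A L w) \<and> M (node v w) = w" if "w \<in> set ws" for w
    using that c' v sym complete_set[OF L] unfolding ws_def by auto
  have rep': "represents (unlink_from (links_of M) v ws) A
      (\<lambda>u. if u \<in> set ws then removeAll v (remaining A L u) else remaining A L u)"
    using ws neighbours_okD(2)[OF complete_ok[OF L] v] unfolding ws_def
    by (intro represents_unlink_from[OF complete_ok[OF L] rep]) auto
  then have rep': "represents (unlink_from (links_of M) v ws) (A - {v}) (remaining (A - {v}) L)"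
    using remaining_remove[OF L v] unfolding represents_def ws_def by fastforce
  have take: "take (Suc h) qs' = take h qs @ [v]" "drop (Suc h) qs' = drop (Suc h) qs @ filter (\<lambda>w. w \<notin> set qs) ws"
    using h unfolding qs'_def v_def by (auto simp: take_Suc_conv_app_nth)
  have "v \<notin> set (drop (Suc h) qs)"
    using qs(2) h unfolding v_def by (metis distinct.simps(2) distinct_drop Cons_nth_drop_Suc)
  moreover have "set (drop (Suc h) qs) \<subseteq> set (drop h qs)" by (simp add: set_drop_subset_set_drop)
  moreover have "v \<notin> set ws" using v irrefl complete_set[OF L] unfolding ws_def by auto
  moreover have "set ws \<subseteq> A" using ws by auto
  ultimately have qs': "(A - {v}) \<inter> set (take (Suc h) qs') = {}" "set (drop (Suc h) qs') \<subseteq> A - {v}"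
    "distinct qs'" "set qs' \<subseteq> {..<n}"
    using c' L neighbours_okD(2)[OF complete_ok[OF L] v]
    unfolding take unfolding qs'_def ws_def complete_def by auto
  have targets: "node u w < 2 * D" "node u w \<noteq> 7 * D + h" "M (node u w) = w" if "u \<in> A" "w \<in> A" "(u, w) \<in> E" for u w
    using that c' node_bounds(2)[of u w] by auto
  show ?thesis
    unfolding include_com_def
    using h len n_less_D W S vn x xW
    apply (simp add: get_def const_regsD[OF R] RhR t Mv boundedD[OF M])
    apply (rule wp_mono[OF scan_com[where L = "remaining A L" and us = "[]" and ws = ws and qs = qs and v = v and A = A]])
                  apply (use R M complete_ok[OF L] rep v ws qs t in \<open>simp_all add: ws_def\<close>)[13]
    apply clarsimp
    subgoal premises p for tm R1 M1
      using p R rep' qs' L complete_mono[OF L, of "A - {v}"]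
        queue_upd_length[of M1 qs' h "length qs"] queue_length[OF qs'(3,4)] targets
      apply (simp add: put_def const_regsD const_regs_cong[of R] bounded_upd config_def links_of_upd RhR)
      apply (simp add: qs'_def)
      done
    done
qed

text \<open>Passing from the inclusion to the exclusion of \<open>v\<close> touches no links, as
  \<open>v\<close> is unlinked in both children. Cutting the queue back to the recorded length
  discards the neighbours that the inclusion added.\<close>

lemma exclude_com:
  assumes R: "const_regs R" and M: "bounded M" and h: "R hR = Suc h" "h < D"
    and v: "M (6 * D + h) = v" and k: "M (7 * D + h) = k" "k \<noteq> 0"
  shows "wp W S back_com (\<lambda>tm out (R', M'). tm = 12 \<and> out = [Del v] \<and>
     (\<forall>r<10. R' r = R r) \<and> R' hR = Suc h \<and> R' tR = k \<and> R' modeR = 1 \<and>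
     M' = M(7 * D + h := 0)) (R, M)"
  using h v k W S boundedD[OF M] unfolding back_com_def
  by (auto simp: get_def put_def const_regsD[OF R])

lemma restore_com:
  assumes R: "const_regs R" and M: "bounded M" and h: "R hR = Suc h" "h < D"
    and v: "M (6 * D + h) = v" "v \<in> A" and k: "M (7 * D + h) = 0"
    and L: "complete A L" "represents l A (remaining A L)"
    and l: "links_of M = unlink_from l v (remaining A L v)"
  shows "wp W S back_com (\<lambda>tm out (R', M'). tm \<le> 10 + 15 * length (remaining A L v) \<and> out = [] \<and>
     (\<forall>r. r < 10 \<or> r = modeR \<longrightarrow> R' r = R r) \<and> bounded M' \<and> R' hR = h \<and>
     links_of M' = l \<and> (\<forall>a. a < 2 * D \<or> 6 * D \<le> a \<longrightarrow> M' a = M a)) (R, M)"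
proof -
  let ?ws = "remaining A L v"
  note ok = complete_ok[OF L(1)]
  have vn: "v < n" using v L unfolding complete_def by auto
  have ws: "w \<in> A \<and> v \<in> set (remaining A L w)" if "w \<in> set ?ws" for w
    using that v sym complete_set[OF L(1)] by auto
  have "v \<notin> set ?ws" using neighbours_okD(3)[OF ok v(2)] by auto
  \<comment> \<open>The list of \<open>v\<close> itself is intact, since \<open>v\<close> was
    unlinked only from the lists of its neighbours; it guides the backward traversal.\<close>
  moreover have "represents (links_of M) A
      (\<lambda>u. if u \<in> set ?ws then removeAll v (remaining A L u) else remaining A L u)"
    unfolding l using ws neighbours_okD(2)[OF ok v(2)]
    by (intro represents_unlink_from[OF ok L(2)]) auto
  ultimately have "dll (links_of M) v (map (node v) ?ws) v"
    using v(2) unfolding represents_def by auto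
  then have x: "M (4 * D + v) = last (v # map (node v) ?ws)"
    using dll_prev[of "links_of M" v "map (node v) ?ws" v] snd_links_of[of v M] vn n_less_D by simp
  have xW: "last (v # map (node v) ?ws) < W" using boundedD[OF M] unfolding x[symmetric] .
  show ?thesis
    unfolding back_com_def
    using h v(1) k W S vn n_less_D x xW
    apply (simp add: get_def const_regsD[OF R] boundedD[OF M] del: last.simps)
    apply (rule wp_mono[OF unscan_com[where l = l and L = "remaining A L" and us = ?ws and vs = "[]" and v = v and A = A]])
               apply (use R M ok L v ws l in simp_all)[10]
    apply clarsimp
    done
qed

text \<open>The whole search is one loop, so a subtree is a stretch of iterations and not a
  subprogram, while \<open>exec\<close> speaks of complete runs of the loop. Quantifying over the
  postcondition of the rest of the run describes a stretch from loop head to loop head, and makes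
  stretches composable.\<close>

definition reaches :: "state \<Rightarrow> nat \<Rightarrow> event list \<Rightarrow> state \<Rightarrow> bool" where
  "reaches s tm out s' \<longleftrightarrow>
     (\<forall>Q. wp W S search_com (\<lambda>tm' out'. Q (tm + tm') (out @ out')) s' \<longrightarrow> wp W S search_com Q s)"

lemma reaches_trans:
  assumes "reaches s tm out s'" "reaches s' tm' out' s''"
  shows "reaches s (tm + tm') (out @ out') s''"
  using assms unfolding reaches_def by (simp add: add.assoc)

lemma reaches_step:
  assumes "0 < R hR" "const_regs R"
    and "wp W S (If (Equal modeR oneR) (If (Less hR tR) include_com (EmitRep ;; Const modeR 0)) back_com) P (R, M)"
  shows "\<exists>tm out R' M'. P tm out (R', M') \<and> reaches (R, M) (1 + tm) out (R', M')"
proof -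
  from assms(3) obtain tm out R' M' where 1: "P tm out (R', M')"
    and 2: "exec W S (If (Equal modeR oneR) (If (Less hR tR) include_com (EmitRep ;; Const modeR 0)) back_com)
      (R, M) tm out (R', M')"
    unfolding wp_def by auto
  have "reaches (R, M) (1 + tm) out (R', M')"
    unfolding reaches_def
  proof (intro allI impI)
    fix Q assume Q: "wp W S search_com (\<lambda>tm' out'. Q (1 + tm + tm') (out @ out')) (R', M')"
    show "wp W S search_com Q (R, M)"
      unfolding search_com_def
      by (rule wp_While_step, use assms in \<open>simp add: const_regsD\<close>, fold search_com_def, unfold wp_def[of _ _ "If _ _ _"])
        (use 2 Q in blast)
  qed
  then show ?thesis using 1 by blast
qed

lemma queue_prefix:
  assumes "queue M (qs @ qs')"
  shows "queue M qs"
  unfolding queue_def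
proof (intro allI impI)
  fix i assume i: "i < length qs"
  then have "(qs @ qs') ! i = qs ! i" by (simp add: nth_append)
  then show "M (6 * D + i) = qs ! i \<and> M (8 * D + qs ! i) = i"
    using assms i unfolding queue_def by (metis length_append trans_less_add1)
qed

lemma reaches_include:
  assumes "0 < R hR" "const_regs R" "R modeR = 1" "R hR < R tR" "wp W S include_com P (R, M)"
  shows "\<exists>tm out R' M'. P tm out (R', M') \<and> reaches (R, M) (3 + tm) out (R', M')"
proof -
  have "wp W S (If (Equal modeR oneR) (If (Less hR tR) include_com (EmitRep ;; Const modeR 0)) back_com)
    (\<lambda>tm out s. \<exists>tm0. tm = 2 + tm0 \<and> P tm0 out s) (R, M)"
    using assms(3,4) const_regsD(2)[OF assms(2)]
    by simp (rule wp_mono[OF assms(5)], simp)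
  from reaches_step[OF assms(1,2) this] obtain tm out R' M' where
    "\<exists>tm0. tm = 2 + tm0 \<and> P tm0 out (R', M')" "reaches (R, M) (1 + tm) out (R', M')" by blast
  then show ?thesis by (auto simp: numeral_3_eq_3)
qed

lemma reaches_back:
  assumes "0 < R hR" "const_regs R" "R modeR = 0" "wp W S back_com P (R, M)"
  shows "\<exists>tm out R' M'. P tm out (R', M') \<and> reaches (R, M) (2 + tm) out (R', M')"
proof -
  have "wp W S (If (Equal modeR oneR) (If (Less hR tR) include_com (EmitRep ;; Const modeR 0)) back_com)
    (\<lambda>tm out s. \<exists>tm0. tm = 1 + tm0 \<and> P tm0 out s) (R, M)"
    using assms(3) const_regsD(2)[OF assms(2)]
    by simp (rule wp_mono[OF assms(4)], simp)
  from reaches_step[OF assms(1,2) this] obtain tm out R' M' where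
    "\<exists>tm0. tm = 1 + tm0 \<and> P tm0 out (R', M')" "reaches (R, M) (1 + tm) out (R', M')" by blast
  then show ?thesis by auto
qed

lemma search_leaf:
  assumes c: "config R M A L (length qs) qs" and h: "0 < length qs" and mode: "R modeR = 1"
  obtains R' where "reaches (R, M) 5 [Rep] (R', M)" "\<forall>r. r \<noteq> modeR \<longrightarrow> R' r = R r" "R' modeR = 0"
proof -
  have R: "const_regs R" and hR: "R hR = length qs" "R tR = length qs"
    using c unfolding config_def by auto
  have h0: "0 < R hR" using h hR by simp
  have "wp W S (If (Equal modeR oneR) (If (Less hR tR) include_com (EmitRep ;; Const modeR 0)) back_com)
    (\<lambda>tm out s'. tm = 4 \<and> out = [Rep] \<and> s' = (R(modeR := 0), M)) (R, M)"
    using R hR mode W by (simp add: const_regsD)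
  from reaches_step[OF h0 R this] have "reaches (R, M) (1 + 4) [Rep] (R(modeR := 0), M)" by blast
  then show thesis using that[of "R(modeR := 0)"] by simp
qed

text \<open>The conclusion restores all that enclosing nodes still read: links, targets, the queue
  up to \<open>qs\<close> and the lengths recorded below \<open>h\<close>. Cells beyond may hold
  leftovers. The condition \<open>0 < h\<close> keeps the loop running when the subtree is
  finished.\<close>

lemma search:
  assumes "config R M A L h qs" "0 < h" "R modeR = 1" "h \<le> length qs"
  shows "\<exists>tm out R' M'. reaches (R, M) tm out (R', M') \<and>
    enumerates_grown E (set (drop h qs)) A out \<and>
    tm + 40 * (length (drop h qs) + 2) \<le> 120 * count_list out Rep \<and>
    (\<forall>r < 10. R' r = R r) \<and> R' hR = h \<and> R' modeR = 0 \<and> bounded M' \<and> links_of M' = links_of M \<and>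
    (\<forall>a < 2 * D. M' a = M a) \<and> queue M' qs \<and> (\<forall>i < h. M' (7 * D + i) = M (7 * D + i))"
  using assms
proof (induction "card A" arbitrary: R M A h qs rule: less_induct)
  case less
  note c = less.prems(1)
  note c' = c[unfolded config_def]
  show ?case
  proof (cases "h = length qs")
    case True
    obtain R' where R': "reaches (R, M) 5 [Rep] (R', M)" "\<forall>r. r \<noteq> modeR \<longrightarrow> R' r = R r" "R' modeR = 0"
      using search_leaf c less.prems True by metis
    show ?thesis
      by (rule exI[of _ 5], rule exI[of _ "[Rep]"], rule exI[of _ R'], rule exI[of _ M])
        (use R' c' True in \<open>simp add: enumerates_grown_leaf\<close>)
  next
    case False
    then have h: "h < length qs" using less.prems by simp
    define v where "v = qs ! h"
    define ws where "ws = remaining A L v"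
    define new where "new = filter (\<lambda>w. w \<notin> set qs) ws"
    define F where "F = drop (Suc h) qs"
    have R: "const_regs R" and L: "complete A L" and rep: "represents (links_of M) A (remaining A L)"
      and qs: "distinct qs" "set qs \<subseteq> {..<n}" and AF: "A \<inter> set (take h qs) = {}" "set (drop h qs) \<subseteq> A"
      and hR: "R hR = h" "R tR = length qs"
      using c' by auto
    have dr: "drop h qs = v # F" unfolding v_def F_def using h by (simp add: Cons_nth_drop_Suc)
    have v: "v \<in> A" using AF dr by auto
    have hD: "h < D" "length qs \<le> n" using queue_length[OF qs] h n_less_D by auto
    have "finite A" using L finite_subset unfolding complete_def by blast
    then have card: "card (A - {v}) < card A" using v by (metis card_Diff1_less)
    have h1: "0 < R hR" and t1: "R hR < R tR" using hR h less.prems(2) by auto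
    obtain tm1 out1 R1 M1 where
      s1: "tm1 \<le> 10 + 25 * length ws" "out1 = [Ins v]" "\<forall>r. r < 10 \<or> r = modeR \<longrightarrow> R1 r = R r"
        "config R1 M1 (A - {v}) L (Suc h) (qs @ new)" "links_of M1 = unlink_from (links_of M) v ws"
        "\<forall>a < 2 * D. M1 a = M a" "M1 (7 * D + h) = length qs"
        "\<forall>i < D. i \<noteq> h \<longrightarrow> M1 (7 * D + i) = M (7 * D + i)"
      and r1: "reaches (R, M) (3 + tm1) out1 (R1, M1)"
      using reaches_include[OF h1 R less.prems(3) t1
          include_com[OF c h, folded v_def, folded ws_def, folded new_def], unfolded prod.case]
      by blast
    note c1' = s1(4)[unfolded config_def]
    have dr1: "drop (Suc h) (qs @ new) = F @ new" and tk1: "take (Suc h) (qs @ new) = take (Suc h) qs"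
      using h unfolding F_def by auto
    obtain tm2 out2 R2 M2 where s2: "enumerates_grown E (set (F @ new)) (A - {v}) out2"
        "tm2 + 40 * (length (F @ new) + 2) \<le> 120 * count_list out2 Rep"
        "\<forall>r < 10. R2 r = R1 r" "R2 hR = Suc h" "R2 modeR = 0" "bounded M2" "links_of M2 = links_of M1"
        "\<forall>a < 2 * D. M2 a = M1 a" "queue M2 (qs @ new)" "\<forall>i < Suc h. M2 (7 * D + i) = M1 (7 * D + i)"
      and r2: "reaches (R1, M1) tm2 out2 (R2, M2)"
      using less.hyps[OF card s1(4)] s1(3) less.prems(3) h unfolding dr1 by auto
    have q2: "queue M2 qs" using s2(9) by (rule queue_prefix)
    have R2: "const_regs R2" using s1(3) s2(3) by (intro const_regs_cong[OF R]) auto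
    have Mv2: "M2 (6 * D + h) = v" using q2 h unfolding queue_def v_def by simp
    have k2: "M2 (7 * D + h) = length qs" "length qs \<noteq> 0" using s2(10) s1(7) h by auto
    have h2: "0 < R2 hR" using s2(4) by simp
    obtain tm3 out3 R3 M3 where
      s3: "tm3 = 12" "out3 = [Del v]" "\<forall>r<10. R3 r = R2 r" "R3 hR = Suc h"
        "R3 tR = length qs" "R3 modeR = 1" "M3 = M2(7 * D + h := 0)"
      and r3: "reaches (R2, M2) (2 + tm3) out3 (R3, M3)"
      using reaches_back[OF h2 R2 s2(5) exclude_com[OF R2 s2(6,4) hD(1) Mv2 k2], unfolded prod.case]
      by blast
    have R3: "const_regs R3" using s3(3) by (intro const_regs_cong[OF R2]) auto
    have l3: "links_of M3 = links_of M1" unfolding s3(7) using s2(7) hD n_less_D by (simp add: links_of_upd)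
    have c3: "config R3 M3 (A - {v}) L (Suc h) qs"
      unfolding config_def
    proof (intro conjI)
      show "bounded M3" using s2(6) W unfolding s3(7) by (simp add: bounded_upd)
      show "queue M3 qs" unfolding s3(7) by (rule queue_upd_length[OF q2 hD(2,1)])
      show "represents (links_of M3) (A - {v}) (remaining (A - {v}) L)" using c1' unfolding l3 by simp
      show "\<forall>u\<in>A - {v}. \<forall>w\<in>A - {v}. (u, w) \<in> E \<longrightarrow> M3 (node u w) = w"
        using c1' s2(8) node_bounds(2) unfolding s3(7) by (fastforce split: if_splits)
      show "complete (A - {v}) L" using c1' by simp
      show "(A - {v}) \<inter> set (take (Suc h) qs) = {}" using c1' unfolding tk1 by simp
      show "set (drop (Suc h) qs) \<subseteq> A - {v}" using c1' unfolding dr1 F_def by simp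
    qed (use R3 s3 qs in auto)
    obtain tm4 out4 R4 M4 where s4: "enumerates_grown E (set F) (A - {v}) out4"
        "tm4 + 40 * (length F + 2) \<le> 120 * count_list out4 Rep"
        "\<forall>r < 10. R4 r = R3 r" "R4 hR = Suc h" "R4 modeR = 0" "bounded M4" "links_of M4 = links_of M3"
        "\<forall>a < 2 * D. M4 a = M3 a" "queue M4 qs" "\<forall>i < Suc h. M4 (7 * D + i) = M3 (7 * D + i)"
      and r4: "reaches (R3, M3) tm4 out4 (R4, M4)"
      using less.hyps[OF card c3] s3(6) h unfolding F_def by auto
    have R4: "const_regs R4" using s4(3) by (intro const_regs_cong[OF R3]) auto
    have Mv4: "M4 (6 * D + h) = v" using s4(9) h unfolding queue_def v_def by simp
    have k4: "M4 (7 * D + h) = 0" using s4(10) unfolding s3(7) by simp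
    have l4: "links_of M4 = unlink_from (links_of M) v (remaining A L v)"
      using s4(7) l3 s1(5) unfolding ws_def by simp
    have h4: "0 < R4 hR" using s4(4) by simp
    obtain tm5 out5 R5 M5 where
      s5: "tm5 \<le> 10 + 15 * length ws" "out5 = []" "\<forall>r. r < 10 \<or> r = modeR \<longrightarrow> R5 r = R4 r"
        "bounded M5" "R5 hR = h" "links_of M5 = links_of M" "\<forall>a. a < 2 * D \<or> 6 * D \<le> a \<longrightarrow> M5 a = M4 a"
      and r5: "reaches (R4, M4) (2 + tm5) out5 (R5, M5)"
      using reaches_back[OF h4 R4 s4(5)
          restore_com[OF R4 s4(6,4) hD(1) Mv4 v k4 L rep l4, folded ws_def], unfolded prod.case]
      by blast
    let ?tm = "(3 + tm1) + (tm2 + ((2 + tm3) + (tm4 + (2 + tm5))))"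
    let ?out = "out1 @ (out2 @ (out3 @ (out4 @ out5)))"
    have reach: "reaches (R, M) ?tm ?out (R5, M5)"
      by (intro reaches_trans[OF r1] reaches_trans[OF r2] reaches_trans[OF r3] reaches_trans[OF r4] r5)
    have out: "?out = Ins v # out2 @ Del v # out4" using s1(2) s3(2) s5(2) by simp
    have wsA: "set ws = {w \<in> A. (v, w) \<in> E}" "distinct ws"
      unfolding ws_def using complete_set[OF L v] neighbours_okD(2)[OF complete_ok[OF L] v] by auto
    have vws: "v \<notin> set ws" using wsA irrefl by auto
    have inF: "w \<in> set F" if "w \<in> A" "w \<in> set qs" "w \<noteq> v" for w
    proof -
      have "w \<in> set (take h qs) \<union> set (drop h qs)" using that(2) by (metis append_take_drop_id set_append)
      then show ?thesis using AF(1) that(1,3) unfolding dr by auto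
    qed
    \<comment> \<open>An undecided neighbour of \<open>v\<close> that is missing from
      \<open>new\<close> was queued before, and by \<open>inF\<close> it is still waiting in
      \<open>F\<close>.\<close>
    have "set (F @ new) \<inter> (A - {v}) = (set F \<union> E `` {v}) \<inter> (A - {v})"
      unfolding new_def using wsA inF by auto
    from enumerates_grown_node[OF v irrefl this s2(1) s4(1)]
    have enum: "enumerates_grown E (set (drop h qs)) A ?out" unfolding dr out by simp
    have sub: "set ws \<subseteq> set (F @ new)"
    proof
      fix w assume w: "w \<in> set ws"
      then have "w \<in> A" "w \<noteq> v" using wsA(1) vws by blast+
      then show "w \<in> set (F @ new)" using inF w unfolding new_def by (cases "w \<in> set qs") simp_all
    qed
    have "length ws = card (set ws)" using wsA(2) by (rule distinct_card[symmetric])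
    also have "\<dots> \<le> card (set (F @ new))" using sub by (rule card_mono[OF finite_set])
    also have "\<dots> \<le> length (F @ new)" by (rule card_length)
    finally have len: "length ws \<le> length F + length new" by simp
    have count: "count_list ?out Rep = count_list out2 Rep + count_list out4 Rep"
      unfolding out by simp
    \<comment> \<open>The node costs at most \<open>39 + 40 * length ws\<close>, from 3 + 10 + 2 +
      12 + 2 + 10 and from 25 + 15 per neighbour. The children supply credits for queue lengths
      \<open>length F + length new\<close> and \<open>length F\<close>, the node must keep one for
      \<open>length F + 1\<close>. The surplus is \<open>40 * (length F + length new + 1)\<close>,
      which suffices by \<open>len\<close>.\<close>
    have time: "?tm + 40 * (length (drop h qs) + 2) \<le> 120 * count_list ?out Rep"
      using s1(1) s2(2) s3(1) s4(2) s5(1) len unfolding count dr by simp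
    have "\<forall>r<10. R5 r = R r" using s1(3) s2(3) s3(3) s4(3) s5(3) by simp
    moreover have "R5 modeR = 0" using s5(3) s4(5) by simp
    moreover have "\<forall>a<2 * D. M5 a = M a" using s1(6) s2(8) s4(8) s5(7) unfolding s3(7) by simp
    moreover have "queue M5 qs" using s4(9) by (rule queue_cong) (use s5(7) n_less_D in simp)
    moreover have "\<forall>i<h. M5 (7 * D + i) = M (7 * D + i)"
      using s1(8) s2(10) s4(10) s5(7) hD unfolding s3(7) by simp
    ultimately show ?thesis using reach enum time s5(4-6) by blast
  qed
qed

end

section \<open>The enumeration over all largest vertices\<close>

definition link_com :: "reg \<Rightarrow> reg \<Rightarrow> com" where
  "link_com a y = get qR nextR a ;; put nextR a y ;; put nextR y qR ;; put prevR y a ;; put prevR qR y"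

text \<open>Block 0 is the input itself: the address of an entry is at the same time the list node
  of its arc, with the target already in place. Only the target of the opposite arc has to be
  stored.\<close>

definition insert_com :: com where
  "insert_com = While (Less iR endR)
     (Load wR iR ;;
      If (Less wR rootR)
        (Add xR iR zeroR ;; Add yR iR DR ;; Store yR rootR ;; link_com rootR xR ;; link_com wR yR)
        Skip ;;
      Add iR iR oneR)"

text \<open>The root is included outside the loop. Its recorded length is then replaced by 0, the
  mark of an excluded vertex, so that backtracking restores the root and stops instead of searching
  for sets without it.\<close>

definition root_search_com :: com where
  "root_search_com = include_com ;; put lengthR zeroR zeroR ;; Const modeR 1 ;; search_com"

definition root_com :: com where
  "root_com = put nextR rootR rootR ;; put prevR rootR rootR ;;
     Add aR rootR oneR ;; Load iR aR ;; Add aR aR oneR ;; Load endR aR ;; insert_com ;;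
     put queueR zeroR rootR ;; put positionR rootR zeroR ;; Add tR oneR zeroR ;; Add hR zeroR zeroR ;;
     root_search_com ;; EmitDel rootR ;; Add rootR rootR oneR"

definition init_com :: com where
  "init_com = Const oneR 1 ;; Load nR zeroR ;; Add aR nR oneR ;; Load DR aR ;;
     Add nextR DR DR ;; Add prevR nextR nextR ;; Add queueR nextR prevR ;;
     Add lengthR queueR DR ;; Add positionR lengthR DR"

definition roots_com :: com where
  "roots_com = While (Less rootR nR) root_com"

definition enumerate_com :: com where
  "enumerate_com = init_com ;; roots_com"

context machine
begin

text \<open>The credit \<open>40 * (length ws + 2)\<close> of the tree pays for including and
  restoring the root. Dropping the time from the same inequality and dividing by 40 yields the lower
  bound on the number of solutions.\<close>

lemma root_search_com:
  assumes c: "config R M {..r} L 0 [r]" and r: "r < n"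
  defines "ws \<equiv> remaining {..r} L r"
  shows "wp W S root_search_com (\<lambda>tm out (R', M'). \<exists>out0. out = Ins r # out0 \<and>
     enumerates_grown E (set ws) {..<r} out0 \<and> tm \<le> 120 * count_list out0 Rep \<and>
     length ws + 2 \<le> 3 * count_list out0 Rep \<and>
     (\<forall>r < 10. R' r = R r) \<and> bounded M' \<and> links_of M' = links_of M \<and> (\<forall>a < 2 * D. M' a = M a)) (R, M)"
proof -
  note c' = c[unfolded config_def]
  have R: "const_regs R" and M: "bounded M" and L: "complete {..r} L"
    and rep: "represents (links_of M) {..r} (remaining {..r} L)" using c' by auto
  have rr: "{..r} - {r} = {..<r}" by auto
  have "set ws = {w \<in> {..r}. (r, w) \<in> E}" unfolding ws_def using complete_set[OF L] by simp
  then have "r \<notin> set ws" using irrefl by simp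
  then have new: "filter (\<lambda>w. w \<notin> set [r]) ws = ws" by (auto simp: filter_id_conv)
  have D0: "0 < D" using n_less_D by simp
  have len: "0 < length [r]" by simp
  have nth: "[r] ! 0 = r" by simp
  note inc = include_com[OF c len, unfolded nth, folded ws_def, unfolded new rr]
  have search: "wp W S search_com (\<lambda>tm out (R', M'). enumerates_grown E (set ws) {..<r} out \<and>
     tm + 40 * (length ws + 2) \<le> 120 * count_list out Rep + 13 + 15 * length ws \<and>
     length ws + 2 \<le> 3 * count_list out Rep \<and>
     (\<forall>r < 10. R' r = R1 r) \<and> bounded M' \<and> links_of M' = links_of M \<and> (\<forall>a < 2 * D. M' a = M1 a)) (R1, M1)"
    if c1: "config R1 M1 {..<r} L 1 ([r] @ ws)" and l1: "links_of M1 = unlink_from (links_of M) r ws"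
      and mode: "R1 modeR = 1" and k1: "M1 (7 * D) = 0" for R1 M1
  proof -
    obtain tm2 out2 R2 M2 where s2: "enumerates_grown E (set ws) {..<r} out2"
        "tm2 + 40 * (length ws + 2) \<le> 120 * count_list out2 Rep"
        "\<forall>r < 10. R2 r = R1 r" "R2 hR = 1" "R2 modeR = 0" "bounded M2" "links_of M2 = links_of M1"
        "\<forall>a < 2 * D. M2 a = M1 a" "queue M2 ([r] @ ws)" "\<forall>i < 1. M2 (7 * D + i) = M1 (7 * D + i)"
      and r2: "reaches (R1, M1) tm2 out2 (R2, M2)"
      using search[OF c1 zero_less_one mode] by auto
    have R2: "const_regs R2"
      using c1 s2(3) unfolding config_def by (auto intro: const_regs_cong[of R1])
    have "M2 (6 * D + 0) = r" using s2(9) unfolding queue_def by force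
    note rest = restore_com[OF R2 s2(6) _ D0 this _ _ L rep]
    have "R2 hR = Suc 0" "r \<in> {..r}" "M2 (7 * D + 0) = 0" using s2(4,10) k1 by auto
    note rest = rest[OF this, folded ws_def, OF trans[OF s2(7) l1]]
    have h2: "0 < R2 hR" using s2(4) by simp
    obtain tm3 out3 R3 M3 where s3: "tm3 \<le> 10 + 15 * length ws" "out3 = []"
        "\<forall>r. r < 10 \<or> r = modeR \<longrightarrow> R3 r = R2 r" "bounded M3" "R3 hR = 0" "links_of M3 = links_of M"
        "\<forall>a. a < 2 * D \<or> 6 * D \<le> a \<longrightarrow> M3 a = M2 a"
      and r3: "reaches (R2, M2) (2 + tm3) out3 (R3, M3)"
      using reaches_back[OF h2 R2 s2(5) rest, unfolded prod.case] by blast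
    have R3: "const_regs R3" using s3(3) by (intro const_regs_cong[OF R2]) auto
    have "reaches (R1, M1) (tm2 + (2 + tm3)) (out2 @ out3) (R3, M3)" by (rule reaches_trans[OF r2 r3])
    then show ?thesis
      unfolding reaches_def
    proof (rule allE, elim impE)
      show "wp W S search_com (\<lambda>tm' out'. (\<lambda>tm out (R', M'). enumerates_grown E (set ws) {..<r} out \<and>
        tm + 40 * (length ws + 2) \<le> 120 * count_list out Rep + 13 + 15 * length ws \<and>
        length ws + 2 \<le> 3 * count_list out Rep \<and>
        (\<forall>r < 10. R' r = R1 r) \<and> bounded M' \<and> links_of M' = links_of M \<and> (\<forall>a < 2 * D. M' a = M1 a))
        (tm2 + (2 + tm3) + tm') ((out2 @ out3) @ out')) (R3, M3)"
        unfolding search_com_def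
        by (rule wp_While_stop) (use s2 s3 const_regsD(1)[OF R3] in auto)
    qed
  qed
  show ?thesis
    unfolding root_search_com_def wp_Seq
  proof (rule wp_mono[OF inc], clarify)
    fix tm R1 M1
    assume tm: "tm \<le> 10 + 25 * length ws" and R1: "\<forall>r. r < 10 \<or> r = modeR \<longrightarrow> R1 r = R r"
      and c1: "config R1 M1 {..<r} L (Suc 0) ([r] @ ws)" and l1: "links_of M1 = unlink_from (links_of M) r ws"
      and M1: "\<forall>a < 2 * D. M1 a = M a"
    note c1' = c1[unfolded config_def]
    have R1c: "const_regs R1" and lenq: "length ([r] @ ws) \<le> n" using c1' queue_length by blast+
    have nd: "node u w \<noteq> 7 * D" if "(u, w) \<in> E" for u w using node_bounds(2)[OF that] by simp
    have c2: "config (R1(aR := 7 * D, modeR := Suc 0)) (M1(7 * D := 0)) {..<r} L 1 ([r] @ ws)"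
      using c1' W nd queue_upd_length[OF _ lenq D0, of M1 0]
      unfolding config_def by (simp add: bounded_upd links_of_upd)
    have l2: "links_of (M1(7 * D := 0)) = unlink_from (links_of M) r ws"
      using l1 by (simp add: links_of_upd)
    show "wp W S (put lengthR zeroR zeroR)
        (\<lambda>t out. wp W S (Const modeR 1)
          (\<lambda>ta outa. wp W S search_com
            (\<lambda>t' out' (R', M'). \<exists>out0.
              [Ins r] @ out @ outa @ out' = Ins r # out0 \<and> enumerates_grown E (set ws) {..<r} out0 \<and>
              tm + (t + (ta + t')) \<le> 120 * count_list out0 Rep \<and>
              length ws + 2 \<le> 3 * count_list out0 Rep \<and>
              (\<forall>r < 10. R' r = R r) \<and> bounded M' \<and> links_of M' = links_of M \<and> (\<forall>a < 2 * D. M' a = M a))))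
        (R1, M1)"
      using W S D0 const_regsD[OF R1c] unfolding put_def
      apply simp
      apply (rule wp_mono[OF search[OF c2 l2]])
        apply (use tm R1 M1 in auto)
      done
  qed
qed

section \<open>Linking a new root into the lists\<close>

lemma link_com:
  assumes R: "const_regs R" and M: "bounded M"
    and a: "a \<notin> {qR, aR}" "R a < 2 * D" and y: "y \<notin> {qR, aR}" "R y < 2 * D" "R a \<noteq> R y"
    and q: "fst (links_of M) (R a) < 2 * D"
  shows "wp W S (link_com a y) (\<lambda>tm out (R', M'). tm = 10 \<and> out = [] \<and>
     (\<forall>r. r \<notin> {qR, aR} \<longrightarrow> R' r = R r) \<and> bounded M' \<and>
     links_of M' = link_after (links_of M) (R a) (R y) \<and>
     (\<forall>a. a < 2 * D \<or> 6 * D \<le> a \<longrightarrow> M' a = M a)) (R, M)"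
proof -
  obtain nx pv where l: "links_of M = (nx, pv)" by (cases "links_of M")
  then have "nx (R a) = M (2 * D + R a)" using fst_links_of[OF a(2), of M] by auto
  then show ?thesis
    using W S a y q boundedD[OF M]
    by (simp add: l link_com_def get_def put_def const_regsD[OF R] links_of_upd
        bounded_upd[OF bounded_upd[OF bounded_upd[OF bounded_upd]]] M)
qed

definition input_ok :: "(nat \<Rightarrow> nat) \<Rightarrow> bool" where
  "input_ok M \<longleftrightarrow> M 0 = n \<and> (\<forall>u\<le>n. M (Suc u) = offset u) \<and>
     (\<forall>u<n. \<forall>j<length (adj ! u). M (offset u + j) = adj ! u ! j)"

lemma input_address:
  assumes "u < n" "j < length (adj ! u)"
  shows "offset u + j < D"
proof -
  have "offset u + j < offset (Suc u)" using assms offset_Suc by simp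
  also have "\<dots> \<le> D" unfolding D_def using assms by (intro offset_mono) simp
  finally show ?thesis .
qed

lemma n2_le_D: "n + 2 \<le> D"
  unfolding D_def offset_def by simp

lemma input_ok_cong: "input_ok M \<Longrightarrow> (\<And>a. a < D \<Longrightarrow> M' a = M a) \<Longrightarrow> input_ok M'"
  using input_address n2_le_D unfolding input_ok_def by simp

text \<open>
  The neighbours of \<open>u\<close> in the graph on \<open>{..r}\<close>, of whose arcs at \<open>r\<close> only those to \<open>Y\<close> are
  present.
\<close>

definition inserted :: "nat \<Rightarrow> nat set \<Rightarrow> nat \<Rightarrow> nat set" where
  "inserted r Y u = {z. z \<le> r \<and> (u, z) \<in> E \<and> (u = r \<longrightarrow> z \<in> Y) \<and> (z = r \<longrightarrow> u \<in> Y)}"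

definition inserting :: "nat \<Rightarrow> nat set \<Rightarrow> (nat \<Rightarrow> nat) \<Rightarrow> (nat \<Rightarrow> nat list) \<Rightarrow> bool" where
  "inserting r Y M L \<longleftrightarrow> input_ok M \<and> bounded M \<and> represents (links_of M) {..r} L \<and>
     (\<forall>u\<le>r. distinct (L u) \<and> set (L u) = inserted r Y u \<and> (\<forall>z\<in>inserted r Y u. M (node u z) = z))"

lemma inserting_ok:
  assumes "inserting r Y M L" "r < n"
  shows "neighbours_ok {..r} L"
  using assms unfolding inserting_def neighbours_ok_def inserted_def by auto

lemma represents_head:
  assumes "neighbours_ok A L" "represents l A L" "w \<in> A"
  shows "fst l w < 2 * D"
proof -
  have "dll l w (map (node w) (L w)) w" using assms unfolding represents_def by blast
  from dll_next[OF this] show ?thesis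
    using neighbours_okD[OF assms(1,3)] n_less_D node_bounds(2) by (cases "L w") auto
qed

lemma neighbours_ok_Cons:
  assumes "neighbours_ok A L" "w \<in> A" "v \<notin> set (L w)" "(w, v) \<in> E"
  shows "neighbours_ok A (L(w := v # L w))"
  using assms unfolding neighbours_ok_def by auto

lemma insert_step:
  assumes R: "const_regs R" and I: "inserting r Y M L" and r: "r < n" "R rootR = r"
    and z: "z < r" "(r, z) \<in> E" "z \<notin> Y" and x: "R iR = node r z" and w: "R wR = z"
  shows "wp W S (Add xR iR zeroR ;; Add yR iR DR ;; Store yR rootR ;; link_com rootR xR ;; link_com wR yR)
    (\<lambda>tm out (R', M'). tm = 23 \<and> out = [] \<and>
     (\<forall>r. r \<notin> {xR, yR, qR, aR} \<longrightarrow> R' r = R r) \<and>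
     inserting r (insert z Y) M' (L(r := z # L r, z := r # L z))) (R, M)"
proof -
  let ?M = "M(node z r := r)"
  let ?l = "links_of M"
  let ?L1 = "L(r := z # L r)"
  let ?L2 = "?L1(z := r # ?L1 z)"
  have M: "bounded M" and rep: "represents ?l {..r} L" using I unfolding inserting_def by auto
  have ok: "neighbours_ok {..r} L" by (rule inserting_ok[OF I r(1)])
  have E: "(z, r) \<in> E" using sym z by blast
  have nz: "node r z < D" "node z r = node r z + D" using node_sym_less[OF z(2)] z(1) by auto
  have Lr: "z \<notin> set (L r)" "r \<notin> set (L z)"
    using I z irrefl unfolding inserting_def inserted_def by auto
  have ok1: "neighbours_ok {..r} ?L1"
    by (rule neighbours_ok_Cons[OF ok]) (use Lr z in auto)
  have ok2: "neighbours_ok {..r} ?L2"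
    by (rule neighbours_ok_Cons[OF ok1]) (use Lr z E in auto)
  have rep1: "represents (link_after ?l r (node r z)) {..r} ?L1"
    using ok rep Lr z by (intro represents_link_after) auto
  have rep2: "represents (link_after (link_after ?l r (node r z)) z (node z r)) {..r} ?L2"
    by (rule represents_link_after[OF ok1 rep1]) (use Lr z E in auto)
  have heads: "fst ?l r < 2 * D" "fst (link_after ?l r (node r z)) z < 2 * D"
    using represents_head[OF ok rep, of r] represents_head[OF ok1 rep1, of z] z by auto
  have nn: "node r z \<noteq> r" "node z r \<noteq> z"
    using node_ne_vertex[OF z(2) r(1)] node_ne_vertex[OF E, of z] z(1) r(1) by auto
  have fin: "inserting r (insert z Y) M' ?L2"
    if M': "bounded M'" "links_of M' = link_after (link_after ?l r (node r z)) z (node z r)"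
      "\<forall>a. a < 2 * D \<longrightarrow> M' a = ?M a" for M'
    unfolding inserting_def
  proof (intro conjI allI impI ballI)
    show "input_ok M'"
      by (rule input_ok_cong[of M]) (use I M'(3) nz in \<open>auto simp: inserting_def\<close>)
    show "bounded M'" by (rule M')
    show "represents (links_of M') {..r} ?L2" unfolding M'(2) by (rule rep2)
    fix u assume u: "u \<le> r"
    show "distinct (?L2 u)" using neighbours_okD(2)[OF ok2, of u] u by simp
    have "inserted r (insert z Y) u
        = (if u = r then insert z (inserted r Y u) else if u = z then insert r (inserted r Y u) else inserted r Y u)"
      using u z E irrefl unfolding inserted_def by auto
    then show "set (?L2 u) = inserted r (insert z Y) u"
      using I u z unfolding inserting_def by auto
    fix y assume y: "y \<in> inserted r (insert z Y) u"
    then have uy: "(u, y) \<in> E" "y \<le> r" unfolding inserted_def by auto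
    have My: "M' (node u y) = ?M (node u y)" using M'(3) node_bounds(2)[OF uy(1)] by simp
    show "M' (node u y) = y"
    proof (cases "u = z \<and> y = r")
      case True
      then show ?thesis using My by simp
    next
      case False
      then have "node u y \<noteq> node z r" using node_inj[OF uy(1) E] by blast
      then have M_eq: "M' (node u y) = M (node u y)" using My by simp
      show ?thesis
      proof (cases "u = r \<and> y = z")
        case True
        have "M (offset r + index r z) = adj ! r ! index r z"
          using I r index(1)[OF z(2)] unfolding inserting_def input_ok_def by auto
        then show ?thesis using M_eq True index(2)[OF z(2)] z(1) unfolding node_def by simp
      next
        case 2: False
        then have "y \<in> inserted r Y u" using y False unfolding inserted_def by auto
        then show ?thesis using M_eq I u unfolding inserting_def by auto
      qed
    qed
  qed
  have Mb: "bounded (M(node r z + D := r))" using M r n_less_D W by (simp add: bounded_upd)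
  have lM: "links_of (M(node r z + D := r)) = ?l" using nz by (simp add: links_of_upd)
  show ?thesis
    unfolding wp_Seq
    using W S nz r(1) n_less_D
    apply (simp add: x const_regsD[OF R] r(2))
    apply (rule wp_mono[OF link_com])
           apply (use R r z heads Mb lM nz n_less_D nn in simp_all)[8]
    apply clarsimp
    subgoal for R1 M1
      apply (rule wp_mono[OF link_com])
             apply (use R r z heads nz n_less_D nn w in \<open>simp_all add: const_regs_cong[of R]\<close>)[8]
      apply (use fin nz w r lM z(1) in auto)
      done
    done
qed

lemma insert_com:
  assumes "const_regs R" "inserting r (set ys) M L" "r < n" "R rootR = r"
    and "adj ! r = ys @ zs" "R iR = offset r + length ys" "R endR = offset r + length (adj ! r)"
  shows "wp W S insert_com (\<lambda>tm out (R', M'). tm \<le> 1 + 30 * length zs \<and> out = [] \<and>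
     (\<forall>r < 10. R' r = R r) \<and> (\<exists>L. inserting r (set (adj ! r)) M' L)) (R, M)"
  using assms
proof (induction zs arbitrary: ys R M L)
  case Nil
  then show ?case unfolding insert_com_def by (intro wp_While_stop) auto
next
  case (Cons z zs)
  note prems = Cons.prems
  have M: "bounded M" "input_ok M" using prems(2) unfolding inserting_def by auto
  have nth: "adj ! r ! length ys = z" and ly: "length ys < length (adj ! r)" using prems(5) by auto
  have z: "(r, z) \<in> E" "z \<notin> set ys" using adj[OF prems(3)] prems(5) by auto
  have i: "R iR < D" "M (R iR) = z"
    using input_address[OF prems(3) ly] M(2) prems(3,6) ly nth unfolding input_ok_def by auto
  have xn: "R iR = node r z" if "z < r"
    using that index_nth[OF prems(3) ly] unfolding nth node_def prems(6) by simp
  have zn: "z < n" using verts2[OF z(1)] .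
  \<comment> \<open>An arc to a larger vertex is skipped here; it enters the lists when that vertex
    becomes the root.\<close>
  have ge: "inserting r (insert z (set ys)) M L" if "\<not> z < r"
  proof -
    have "r < z" using that z irrefl by (metis linorder_neqE_nat)
    then have "inserted r (insert z (set ys)) u = inserted r (set ys) u" if "u \<le> r" for u
      using that unfolding inserted_def by auto
    then show ?thesis using prems(2) unfolding inserting_def by simp
  qed
  have step: "wp W S (Load wR iR ;;
      If (Less wR rootR)
        (Add xR iR zeroR ;; Add yR iR DR ;; Store yR rootR ;; link_com rootR xR ;; link_com wR yR)
        Skip ;;
      Add iR iR oneR)
    (\<lambda>tm out (R', M'). tm \<le> 29 \<and> out = [] \<and> (\<forall>r. r < 10 \<or> r = endR \<longrightarrow> R' r = R r) \<and>
      R' iR = Suc (R iR) \<and> (\<exists>L. inserting r (insert z (set ys)) M' L)) (R, M)"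
  proof (cases "z < r")
    case True
    have R': "const_regs (R(wR := z))" using prems(1) by simp
    have iW: "R iR < W" "R iR < S" "Suc (R iR) < W" "z < W" using W S i n_less_D zn by auto
    show ?thesis
      unfolding wp_Seq[of _ _ "Load _ _"] wp_Seq[of _ _ "If _ _ _"] wp_Load wp_If
      using iW prems(4) True xn[OF True] i
      apply (simp del: wp_Seq)
      apply (rule wp_mono[OF insert_step[OF R' prems(2,3) _ True z]])
         apply (use prems(4) const_regsD[OF prems(1)] in auto)
      done
  next
    case False
    then show ?thesis
      using W S i n_less_D M const_regsD[OF prems(1)] prems(2,4) zn ge by auto
  qed
  show ?case
    unfolding insert_com_def
  proof (rule wp_While_step, use prems(6,7) ly in simp, rule wp_mono[OF step], fold insert_com_def, clarify)
    fix tm :: nat and R1 M1 L1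
    assume p: "tm \<le> 29" "\<forall>r. r < 10 \<or> r = endR \<longrightarrow> R1 r = R r" "R1 iR = Suc (R iR)"
      and L1: "inserting r (insert z (set ys)) M1 L1"
    show "wp W S insert_com
      (\<lambda>t' out' (R', M'). 1 + tm + t' \<le> 1 + 30 * length (z # zs) \<and> [] @ out' = [] \<and>
       (\<forall>r < 10. R' r = R r) \<and> (\<exists>L. inserting r (set (adj ! r)) M' L)) (R1, M1)"
      by (rule wp_mono[OF Cons.IH[of R1 "ys @ [z]" M1 L1]])
        (use prems p L1 const_regs_cong[OF prems(1), of R1] in auto)
  qed
qed

section \<open>Passing from one root to the next\<close>

definition family :: "nat \<Rightarrow> nat set set" where
  "family r = insert r ` grown E {z. z < r \<and> (r, z) \<in> E} {..<r}"

text \<open>The invariant between two roots: the lists describe the graph induced on the vertices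
  below \<open>r\<close>, in whatever order the insertions produced.\<close>

definition prepared :: "nat \<Rightarrow> (reg \<Rightarrow> nat) \<Rightarrow> (nat \<Rightarrow> nat) \<Rightarrow> bool" where
  "prepared r R M \<longleftrightarrow> const_regs R \<and> R rootR = r \<and> input_ok M \<and> bounded M \<and>
     (\<exists>L. represents (links_of M) {..<r} L \<and>
       (\<forall>u<r. distinct (L u) \<and> set (L u) = {z. z < r \<and> (u, z) \<in> E} \<and>
         (\<forall>z<r. (u, z) \<in> E \<longrightarrow> M (node u z) = z)))"

lemma reported_family:
  assumes "enumerates_grown E F {..<r} out" "F = {z. z < r \<and> (r, z) \<in> E}"
  shows "distinct (reported {} (Ins r # out @ [Del r]))"
    and "set (reported {} (Ins r # out @ [Del r])) = family r"
    and "current {} (Ins r # out @ [Del r]) = {}"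
proof -
  have "{r} \<inter> {..<r} = {}" by simp
  then have "distinct (reported {r} out) \<and> set (reported {r} out) = (\<union>) {r} ` grown E F {..<r} \<and> current {r} out = {r}"
    using assms(1) unfolding enumerates_grown_def by blast
  then show "distinct (reported {} (Ins r # out @ [Del r]))"
    "set (reported {} (Ins r # out @ [Del r])) = family r"
    "current {} (Ins r # out @ [Del r]) = {}"
    unfolding family_def assms(2) by auto
qed

text \<open>An empty circular list is a sentinel linked to itself. The cells of \<open>r\<close>
  occur in no other list, because those consist of arc nodes, which are at least \<open>n\<close>,
  and of sentinels below \<open>r\<close>.\<close>

lemma init_sentinel:
  assumes p: "prepared r R M" and r: "r < n"
  shows "\<exists>L. inserting r {} (M(2 * D + r := r, 4 * D + r := r)) L"
proof -
  let ?M = "M(2 * D + r := r, 4 * D + r := r)"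
  from p obtain L where L: "represents (links_of M) {..<r} L"
    "\<And>u. u < r \<Longrightarrow> distinct (L u)" "\<And>u. u < r \<Longrightarrow> set (L u) = {z. z < r \<and> (u, z) \<in> E}"
    "\<And>u z. u < r \<Longrightarrow> z < r \<Longrightarrow> (u, z) \<in> E \<Longrightarrow> M (node u z) = z"
    unfolding prepared_def by blast
  have M: "input_ok M" "bounded M" using p unfolding prepared_def by auto
  have rD: "r < 2 * D" using r n_less_D by simp
  then have lM: "links_of ?M = ((fst (links_of M))(r := r), (snd (links_of M))(r := r))"
    by (simp add: links_of_upd)
  have "dll (links_of ?M) u (map (node u) ((L(r := [])) u)) u" if "u \<le> r" for u
  proof (cases "u = r")
    case True
    then show ?thesis unfolding lM by simp
  next
    case False
    then have u: "u < r" using that by simp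
    have "z \<noteq> r" if "z \<in> insert u (node u ` set (L u))" for z
      using that u L(3)[OF u] node_ne_vertex r by auto
    then have "dll (links_of ?M) u (map (node u) (L u)) u \<longleftrightarrow> dll (links_of M) u (map (node u) (L u)) u"
      unfolding lM by (intro dll_cong) simp_all
    then show ?thesis using L(1) u unfolding represents_def by simp
  qed
  then have "represents (links_of ?M) {..r} (L(r := []))" unfolding represents_def by simp
  moreover have "set ((L(r := [])) u) = inserted r {} u" if "u \<le> r" for u
    using that L(3)[of u] unfolding inserted_def by (auto simp: le_less)
  moreover have "distinct ((L(r := [])) u)" if "u \<le> r" for u
    using that L(2)[of u] by simp
  moreover have "?M (node u z) = z" if "u \<le> r" "z \<in> inserted r {} u" for u z
  proof -
    have "u < r" "z < r" "(u, z) \<in> E" using that unfolding inserted_def by (auto simp: le_less)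
    then show ?thesis using L(4) node_bounds(2)[of u z] by simp
  qed
  moreover have "input_ok ?M" by (rule input_ok_cong[OF M(1)]) simp
  moreover have "bounded ?M" using M(2) W r n_less_D by (simp add: bounded_upd)
  ultimately have "inserting r {} ?M (L(r := []))" unfolding inserting_def by blast
  then show ?thesis by blast
qed

lemma inserting_full:
  assumes "inserting r (set (adj ! r)) M L" "r < n"
  shows "complete {..r} L" "represents (links_of M) {..r} (remaining {..r} L)"
    "\<And>u. u \<le> r \<Longrightarrow> set (L u) = {z. z \<le> r \<and> (u, z) \<in> E}"
    "\<And>u. u \<le> r \<Longrightarrow> remaining {..r} L u = L u"
    "\<And>u z. u \<le> r \<Longrightarrow> z \<le> r \<Longrightarrow> (u, z) \<in> E \<Longrightarrow> M (node u z) = z"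
proof -
  have ins: "inserted r (set (adj ! r)) u = {z. z \<le> r \<and> (u, z) \<in> E}" for u
    using adj[OF assms(2)] sym unfolding inserted_def by auto
  show L: "set (L u) = {z. z \<le> r \<and> (u, z) \<in> E}" if "u \<le> r" for u
    using assms(1) that unfolding inserting_def ins by blast
  show rem: "remaining {..r} L u = L u" if "u \<le> r" for u
    using L[OF that] unfolding remaining_def by (auto simp: filter_id_conv)
  show "complete {..r} L"
    using assms rem L unfolding complete_def inserting_def by auto
  show "represents (links_of M) {..r} (remaining {..r} L)"
    using assms(1) rem unfolding inserting_def represents_def by simp
  show "M (node u z) = z" if "u \<le> r" "z \<le> r" "(u, z) \<in> E" for u z
    using assms(1) that unfolding inserting_def ins by blast
qed

lemma root_config:
  assumes L: "inserting r (set (adj ! r)) M L" and r: "r < n"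
    and R: "const_regs R" "R hR = 0" "R tR = 1"
  shows "config R (M(6 * D := r, 8 * D + r := 0)) {..r} L 0 [r]"
proof -
  have nd: "node u w \<noteq> 6 * D" "node u w \<noteq> 8 * D + r" if "(u, w) \<in> E" for u w
    using node_bounds(2)[OF that] by simp_all
  have "bounded (M(6 * D := r, 8 * D + r := 0))"
    using L r n_less_D W unfolding inserting_def by (simp add: bounded_upd)
  moreover have "queue (M(6 * D := r, 8 * D + r := 0)) [r]"
    using n_less_D unfolding queue_def by simp
  ultimately show ?thesis
    using inserting_full[OF L r] nd R r n_less_D unfolding config_def by (simp add: links_of_upd)
qed

lemma prepared_Suc:
  assumes L: "inserting r (set (adj ! r)) M L" and r: "r < n"
    and M': "links_of M' = links_of M" "\<forall>a < 2 * D. M' a = M a" "bounded M'"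
    and R: "const_regs R" "R rootR = Suc r"
  shows "prepared (Suc r) R M'"
proof -
  have "represents (links_of M') {..<Suc r} L"
    using L unfolding M'(1) inserting_def lessThan_Suc_atMost by simp
  moreover have "input_ok M'"
    by (rule input_ok_cong[of M]) (use L M' in \<open>auto simp: inserting_def\<close>)
  moreover have "distinct (L u) \<and> set (L u) = {z. z < Suc r \<and> (u, z) \<in> E} \<and>
      (\<forall>z<Suc r. (u, z) \<in> E \<longrightarrow> M' (node u z) = z)" if "u < Suc r" for u
    using that L inserting_full(3,5)[OF L r] M'(2) node_bounds(2)
    unfolding inserting_def less_Suc_eq_le by auto
  ultimately show ?thesis using M'(3) R unfolding prepared_def by blast
qed

lemma root_com:
  assumes p: "prepared r R M" and r: "r < n"
  shows "wp W S root_com (\<lambda>tm out (R', M'). prepared (Suc r) R' M' \<and>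
     (\<exists>out0. out = Ins r # out0 @ [Del r] \<and> enumerates_grown E {z. z < r \<and> (r, z) \<in> E} {..<r} out0 \<and>
       tm \<le> 30 + 30 * length (adj ! r) + 120 * count_list out0 Rep \<and>
       card {z. z < r \<and> (r, z) \<in> E} + 2 \<le> 3 * count_list out0 Rep)) (R, M)"
proof -
  have R: "const_regs R" "R rootR = r" and I: "input_ok M" and M: "bounded M"
    using p unfolding prepared_def by auto
  let ?M = "M(2 * D + r := r, 4 * D + r := r)"
  obtain L where L: "inserting r {} ?M L" using init_sentinel[OF p r] by blast
  have off: "M (Suc r) = offset r" "M (Suc (Suc r)) = offset (Suc r)"
    using I r unfolding input_ok_def by auto
  have bounds: "r + 2 < D" "r < W" "offset r < W" "offset (Suc r) < W"
    using r n2_le_D boundedD[OF M, of "Suc r"] boundedD[OF M, of "Suc (Suc r)"] off W by auto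
  show ?thesis
    unfolding root_com_def
    using W S bounds
    apply (simp add: put_def const_regsD[OF R(1)] R(2) off)
    apply (rule wp_mono[OF insert_com[of _ r "[]" _ L]])
           apply (use R r L offset_Suc[OF r] in simp_all)[7]
    apply clarify
    subgoal premises p1 for tm1 _ R1 M1 L1
    proof -
      have R1: "const_regs R1" "R1 rootR = r" using p1(7) R by (auto intro: const_regs_cong)
      have L1: "inserting r (set (adj ! r)) M1 L1" using p1(8) .
      have rem: "remaining {..r} L1 r = L1 r" "set (L1 r) = {z. z < r \<and> (r, z) \<in> E}"
        using inserting_full(3,4)[OF L1 r, of r] irrefl by (auto simp: le_less)
      have "length (L1 r) = card (set (L1 r))"
        using L1 unfolding inserting_def by (intro distinct_card[symmetric]) blast
      note rem = rem this
      let ?M1 = "M1(6 * D := r, 8 * D + r := 0)"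
      have lM: "links_of ?M1 = links_of M1" using n_less_D by (simp add: links_of_upd)
      show ?thesis
        using W S bounds R1(2)
        apply (simp add: const_regsD[OF R1(1)])
        apply (rule wp_mono[OF root_search_com[OF root_config[OF L1 r] r, unfolded rem lM]])
           apply (use R1 in simp_all)[3]
        apply clarify
        subgoal premises p2 for tm2 _ R2 M2 out0
        proof -
          have R2: "const_regs R2" "R2 rootR = r"
            using p2(10) R1 by (auto intro!: const_regs_cong[OF R1(1), of R2])
          have "prepared (Suc r) (R2(rootR := Suc r)) M2"
            using p2 R2 by (intro prepared_Suc[OF L1 r]) auto
          then show ?thesis
            using p2 p1(6) by (simp add: R2(2) const_regsD[OF R2(1)])
        qed
        done
    qed
    done
qed

lemma roots_com:
  assumes "prepared r R M" "r \<le> n"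
  shows "wp W S roots_com (\<lambda>tm out s'.
     distinct (reported {} out) \<and> set (reported {} out) = (\<Union>u\<in>{r..<n}. family u) \<and>
     tm \<le> 1 + (\<Sum>u=r..<n. 31 + 30 * length (adj ! u)) + 120 * count_list out Rep \<and>
     (\<Sum>u=r..<n. card {z. z < u \<and> (u, z) \<in> E} + 2) \<le> 3 * count_list out Rep) (R, M)"
  using assms
proof (induction "n - r" arbitrary: r R M)
  case 0
  then have "r = n" "const_regs R" "R rootR = r" unfolding prepared_def by auto
  then show ?case unfolding roots_com_def by (intro wp_While_stop) (auto simp: const_regsD)
next
  case (Suc k)
  then have r: "r < n" and R: "const_regs R" "R rootR = r" unfolding prepared_def by auto
  \<comment> \<open>Every set in \<open>family u\<close> contains \<open>u\<close>, which exceeds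
    all elements of the sets in \<open>family r\<close>.\<close>
  have disj: "family r \<inter> (\<Union>u\<in>{Suc r..<n}. family u) = {}"
  proof -
    have mem: "u \<in> U" if "U \<in> family u" for U u using that unfolding family_def by auto
    have sub: "U \<subseteq> {..r}" if "U \<in> family r" for U
      using that grown_subset unfolding family_def by fastforce
    have "U \<notin> family u" if "U \<in> family r" "u \<in> {Suc r..<n}" for U u
    proof
      assume "U \<in> family u"
      from subsetD[OF sub[OF that(1)] mem[OF this]] have "u \<le> r" by (rule atMost_iff[THEN iffD1])
      then show False using that(2) by simp
    qed
    then show ?thesis by (intro equals0I) (elim IntE UN_E, blast)
  qed
  have split: "{r..<n} = insert r {Suc r..<n}" using r by auto
  show ?case
    unfolding roots_com_def
    apply (rule wp_While_step)
    using R r apply (simp add: const_regsD)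
    apply (rule wp_mono[OF root_com[OF Suc.prems(1) r]])
    apply (fold roots_com_def)
    apply clarify
  proof -
    fix tm :: nat and R1 M1 out0
    assume p1: "prepared (Suc r) R1 M1"
      and enum: "enumerates_grown E {z. z < r \<and> (r, z) \<in> E} {..<r} out0"
      and tm: "tm \<le> 30 + 30 * length (adj ! r) + 120 * count_list out0 Rep"
      and card: "card {z. z < r \<and> (r, z) \<in> E} + 2 \<le> 3 * count_list out0 Rep"
    let ?o = "Ins r # out0 @ [Del r]"
    note rep = reported_family[OF enum refl]
    have count: "count_list ?o Rep = count_list out0 Rep" by simp
    let ?a = "\<lambda>u. 31 + 30 * length (adj ! u)" and ?b = "\<lambda>u. card {z. z < u \<and> (u, z) \<in> E} + 2"
    have sums: "sum ?a {r..<n} = ?a r + sum ?a {Suc r..<n}" "sum ?b {r..<n} = ?b r + sum ?b {Suc r..<n}"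
      using r by (simp_all only: sum.atLeast_Suc_lessThan)
    show "wp W S roots_com (\<lambda>t' out' s'.
       distinct (reported {} (?o @ out')) \<and> set (reported {} (?o @ out')) = (\<Union>u\<in>{r..<n}. family u) \<and>
       1 + tm + t' \<le> 1 + sum ?a {r..<n} + 120 * count_list (?o @ out') Rep \<and>
       sum ?b {r..<n} \<le> 3 * count_list (?o @ out') Rep) (R1, M1)"
      unfolding reported_append rep(3) count_list_append count set_append distinct_append rep(2) sums
    proof (rule wp_mono[OF Suc.hyps(1)[of "Suc r" R1 M1]])
      show "k = n - Suc r" "Suc r \<le> n" using Suc.hyps(2) r by auto
      show "prepared (Suc r) R1 M1" by (rule p1)
      fix t' out' s'
      assume IH: "distinct (reported {} out') \<and> set (reported {} out') = (\<Union>u\<in>{Suc r..<n}. family u) \<and>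
        t' \<le> 1 + sum ?a {Suc r..<n} + 120 * count_list out' Rep \<and>
        sum ?b {Suc r..<n} \<le> 3 * count_list out' Rep"
      then have set: "set (reported {} out') = (\<Union>u\<in>{Suc r..<n}. family u)" by blast
      have "(distinct (reported {} ?o) \<and> distinct (reported {} out') \<and> family r \<inter> set (reported {} out') = {})"
        using IH rep(1) disj unfolding set by blast
      moreover have "family r \<union> set (reported {} out') = (\<Union>u\<in>{r..<n}. family u)"
        unfolding set split by blast
      moreover have "1 + tm + t' \<le> 1 + (?a r + sum ?a {Suc r..<n}) + 120 * (count_list out0 Rep + count_list out' Rep)"
        using IH[THEN conjunct2, THEN conjunct2, THEN conjunct1] tm by simp
      moreover have "?b r + sum ?b {Suc r..<n} \<le> 3 * (count_list out0 Rep + count_list out' Rep)"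
        using IH[THEN conjunct2, THEN conjunct2, THEN conjunct2] card by simp
      ultimately show "(distinct (reported {} ?o) \<and> distinct (reported {} out') \<and> family r \<inter> set (reported {} out') = {}) \<and>
        family r \<union> set (reported {} out') = (\<Union>u\<in>{r..<n}. family u) \<and>
        1 + tm + t' \<le> 1 + (?a r + sum ?a {Suc r..<n}) + 120 * (count_list out0 Rep + count_list out' Rep) \<and>
        ?b r + sum ?b {Suc r..<n} \<le> 3 * (count_list out0 Rep + count_list out' Rep)"
        by blast
    qed
  qed
qed

lemma init_com:
  assumes M: "input_ok M" "bounded M"
  shows "wp W S init_com (\<lambda>tm out (R', M'). tm = 9 \<and> out = [] \<and> prepared 0 R' M') (\<lambda>_. 0, M)"
proof -
  \<comment> \<open>The header has one offset more than there are vertices; the last one is the end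
    address of the input and thus the block length \<open>D\<close>.\<close>
  have "M 0 = n" "M (Suc n) = D" using M(1) unfolding input_ok_def D_def by auto
  then show ?thesis
    using W S n2_le_D M unfolding init_com_def
    by (simp add: prepared_def const_regs_def represents_def)
qed

lemma enumerate_com:
  assumes "input_ok M" "bounded M"
  shows "wp W S enumerate_com (\<lambda>tm out s'.
     distinct (reported {} out) \<and> set (reported {} out) = (\<Union>u<n. family u) \<and>
     tm \<le> 10 + (\<Sum>u<n. 31 + 30 * length (adj ! u)) + 120 * count_list out Rep \<and>
     (\<Sum>u<n. card {z. z < u \<and> (u, z) \<in> E} + 2) \<le> 3 * count_list out Rep) (\<lambda>_. 0, M)"
  unfolding enumerate_com_def wp_Seq
  by (rule wp_mono[OF init_com[OF assms]], clarify, rule wp_mono[OF roots_com])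
    (auto simp: atLeast0LessThan)

end

section \<open>Counting edges\<close>

lemma finite_uedges:
  assumes "pair_graph G"
  shows "finite (uedges G)"
proof -
  interpret pair_graph G by (rule assms)
  have "uedges G = (\<lambda>(u, v). {u, v}) ` parcs G" unfolding uedges_def by auto
  then show ?thesis using pair_finite_arcs by simp
qed

text \<open>The arcs are the descending ones and their reversals, and a descending arc is determined
  by its edge.\<close>

lemma card_parcs:
  fixes G :: "nat pair_pre_digraph"
  assumes G: "pair_graph G" and V: "pverts G = {..<n}"
  shows "card (parcs G) = 2 * (\<Sum>u<n. card {z. z < u \<and> (u, z) \<in> parcs G})"
    and "(\<Sum>u<n. card {z. z < u \<and> (u, z) \<in> parcs G}) \<le> card (uedges G)"
proof -
  interpret pair_graph G by (rule G)
  have sym: "(y, x) \<in> parcs G" if "(x, y) \<in> parcs G" for x y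
    using pair_sym_arcs that by (auto simp: symmetric_def sym_def)
  have irrefl: "(x, x) \<notin> parcs G" for x using pair_no_loops[of "(x, x)"] by auto
  let ?D = "{(u, z). z < u \<and> (u, z) \<in> parcs G}"
  have fin: "finite ?D" by (rule finite_subset[OF _ pair_finite_arcs]) auto
  have "?D = Sigma {..<n} (\<lambda>u. {z. z < u \<and> (u, z) \<in> parcs G})"
    using in_arcsD1 V by auto
  then have D: "card ?D = (\<Sum>u<n. card {z. z < u \<and> (u, z) \<in> parcs G})" by simp
  have "parcs G = ?D \<union> prod.swap ` ?D"
  proof (intro subset_antisym subsetI)
    fix e assume "e \<in> parcs G"
    then show "e \<in> ?D \<union> prod.swap ` ?D"
      using irrefl sym by (cases e, cases "fst e" "snd e" rule: linorder_cases) force+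
  qed (use sym in auto)
  then have "card (parcs G) = card (?D \<union> prod.swap ` ?D)" by (rule arg_cong)
  also have "\<dots> = card ?D + card (prod.swap ` ?D)"
    by (rule card_Un_disjoint[OF fin finite_imageI[OF fin]]) auto
  also have "card (prod.swap ` ?D) = card ?D" by (intro card_image) auto
  finally have "card (parcs G) = card ?D + card ?D" .
  then show "card (parcs G) = 2 * (\<Sum>u<n. card {z. z < u \<and> (u, z) \<in> parcs G})" unfolding D by simp
  have "inj_on (\<lambda>(u, z). {u, z}) ?D" by (auto simp: inj_on_def doubleton_eq_iff)
  moreover have "(\<lambda>(u, z). {u, z}) ` ?D \<subseteq> uedges G" unfolding uedges_def by auto
  ultimately show "(\<Sum>u<n. card {z. z < u \<and> (u, z) \<in> parcs G}) \<le> card (uedges G)"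
    unfolding D[symmetric] using finite_uedges[OF G] by (rule card_inj_on_le)
qed

section \<open>The memory image of the input\<close>

lemma length_input_image: "length (input_image adj) = length adj + 2 + length (concat adj)"
  unfolding input_image_def by simp

lemma input_image_nth:
  "input_image adj ! 0 = length adj"
  "u \<le> length adj \<Longrightarrow> input_image adj ! Suc u = length adj + 2 + length (concat (take u adj))"
  "a < length (concat adj) \<Longrightarrow> input_image adj ! (length adj + 2 + a) = concat adj ! a"
proof -
  let ?h = "map (\<lambda>i. length adj + 2 + length (concat (take i adj))) [0..<length adj + 1]"
  have len: "length ?h = length adj + 1" by simp
  show "input_image adj ! 0 = length adj" unfolding input_image_def by simp
  show "input_image adj ! Suc u = length adj + 2 + length (concat (take u adj))" if "u \<le> length adj"
    using that unfolding input_image_def nth_Cons_Suc nth_append len by (simp del: upt_Suc)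
  show "input_image adj ! (length adj + 2 + a) = concat adj ! a" if "a < length (concat adj)"
    using that unfolding input_image_def by (simp add: nth_append del: upt_Suc)
qed

lemma concat_nth:
  assumes "u < length xs" "j < length (xs ! u)"
  shows "concat xs ! (length (concat (take u xs)) + j) = xs ! u ! j"
    and "length (concat (take u xs)) + j < length (concat xs)"
proof -
  have "xs = take u xs @ xs ! u # drop (Suc u) xs" using assms(1) by (simp add: id_take_nth_drop)
  then have c: "concat xs = concat (take u xs) @ xs ! u @ concat (drop (Suc u) xs)"
    by (metis concat.simps(2) concat_append)
  show "concat xs ! (length (concat (take u xs)) + j) = xs ! u ! j"
    unfolding c using assms by (simp add: nth_append)
  show "length (concat (take u xs)) + j < length (concat xs)"
    using assms unfolding c length_append by simp
qed

lemma (in machine) initial_state_ok: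
  assumes "initial_state adj = (R, M)"
  shows "input_ok M" "bounded M" "R = (\<lambda>_. 0)"
proof -
  have M: "M a = (if a < length (input_image adj) then input_image adj ! a else 0)" for a
    using assms unfolding initial_state_def by auto
  show "R = (\<lambda>_. 0)" using assms unfolding initial_state_def by simp
  have D: "D = length (input_image adj)" unfolding D_def offset_def length_input_image by simp
  show "input_ok M"
    unfolding input_ok_def
  proof (intro conjI allI impI)
    show "M 0 = n" unfolding M D[symmetric] using n2_le_D by (simp add: input_image_nth)
    show "M (Suc u) = offset u" if "u \<le> n" for u
      unfolding M D[symmetric] offset_def using n2_le_D that by (simp add: input_image_nth)
    fix u j assume uj: "u < n" "j < length (adj ! u)"
    then have "offset u + j < length (input_image adj)" using input_address D by simp
    moreover have "input_image adj ! (offset u + j) = adj ! u ! j"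
      using input_image_nth(3)[OF concat_nth(2)[OF uj]] concat_nth(1)[OF uj]
      unfolding offset_def by (simp only: add.assoc)
    ultimately show "M (offset u + j) = adj ! u ! j" unfolding M by simp
  qed
  have "x \<le> D" if x: "x \<in> set (input_image adj)" for x
  proof -
    consider "x = n" | u where "u \<le> n" "x = offset u" | "x \<in> set (concat adj)"
      using x unfolding input_image_def offset_def by (auto simp: less_Suc_eq_le simp del: upt_Suc)
    then show ?thesis
    proof cases
      case 1
      then show ?thesis using n2_le_D by simp
    next
      case 2
      then show ?thesis using offset_mono[of u n] unfolding D_def by simp
    next
      case 3
      then obtain u where "u < n" "x \<in> set (adj ! u)" by (metis UN_E in_set_conv_nth set_concat)
      then have "x < n" using adj verts2 by blast
      then show ?thesis using n_less_D by simp
    qed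
  qed
  then have "M a \<le> D" for a unfolding M by simp
  moreover have "D < W" using W by simp
  ultimately have "M a < W" for a by (rule le_less_trans)
  then show "bounded M" unfolding bounded_def by blast
qed

theorem theorem4:
  shows "\<exists>(p :: com) (c :: real) (d :: nat) (k :: nat).
    \<forall>(G :: nat pair_pre_digraph) (adj :: nat list list).
      pair_graph G \<and> adjacency_lists G adj \<longrightarrow>
      (\<exists>t out s'.
         exec ((card (pverts G) + card (uedges G) + 2) ^ k)
              (d * (card (pverts G) + card (uedges G) + 1))
              p (initial_state adj) t out s' \<and>
         enumerates out (connected_vertex_sets G) \<and>
         real t / real (card (connected_vertex_sets G)) \<le> c)"
proof (rule exI[of _ enumerate_com], rule exI[of _ 310], rule exI[of _ 18], rule exI[of _ 6],
    intro allI impI)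
  fix G :: "nat pair_pre_digraph" and adj :: "nat list list"
  assume A: "pair_graph G \<and> adjacency_lists G adj"
  then have G: "pair_graph G" and V: "pverts G = {..<length adj}"
    and adj: "\<And>u. u < length adj \<Longrightarrow> distinct (adj ! u) \<and> set (adj ! u) = {v. (u, v) \<in> parcs G}"
    unfolding adjacency_lists_def by auto
  interpret G: pair_graph G by (rule G)
  interpret a: adjacency "parcs G" adj
  proof
    show "(v, u) \<in> parcs G" if "(u, v) \<in> parcs G" for u v
      using G.pair_sym_arcs that by (auto simp: symmetric_def sym_def)
    show "(u, u) \<notin> parcs G" for u using G.pair_no_loops[of "(u, u)"] by auto
    show "u < length adj" if "(u, v) \<in> parcs G" for u v using G.in_arcsD1[OF that] V by simp
  qed (use adj in blast)
  let ?n = "length adj"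
  let ?m = "card (uedges G)"
  let ?x = "card (pverts G) + ?m + 2"
  let ?low = "\<Sum>u<?n. card {z. z < u \<and> (u, z) \<in> parcs G}"
  have n: "card (pverts G) = ?n" using V by simp
  have "parcs G = Sigma {..<?n} (\<lambda>u. set (adj ! u))" using adj a.verts by auto
  then have "card (parcs G) = (\<Sum>u<?n. card (set (adj ! u)))" by simp
  also have "\<dots> = (\<Sum>u<?n. length (adj ! u))" by (intro sum.cong refl distinct_card) (use adj in auto)
  finally have arcs: "(\<Sum>u<?n. length (adj ! u)) = 2 * ?low" using card_parcs(1)[OF G V] by simp
  have "length (concat adj) = (\<Sum>u<?n. length (adj ! u))"
    by (simp add: length_concat sum_list_sum_nth atLeast0LessThan)
  \<comment> \<open>Each edge occurs in two adjacency lists. Nine blocks of this length fit into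
    \<open>18 * (?n + ?m + 1)\<close> cells, which is the origin of the factor 18.\<close>
  then have D: "a.D \<le> 2 * (?n + ?m + 1)"
    using arcs card_parcs(2)[OF G V] unfolding a.D_def a.offset_def by simp
  \<comment> \<open>The factor 18 is below \<open>2 ^ 5\<close>, and \<open>?x\<close> is at least
    2; this leads to the exponent 6 for the word size.\<close>
  have "9 * a.D < 2 ^ 5 * ?x" using D n by simp
  also have "\<dots> \<le> ?x ^ 5 * ?x" by (intro mult_le_mono1 power_mono) auto
  finally have W: "9 * a.D < ?x ^ 6" unfolding power_Suc2[symmetric] by (simp only: Suc_numeral add_num_simps)
  interpret m: machine "parcs G" adj "?x ^ 6" "18 * (card (pverts G) + ?m + 1)"
    by unfold_locales (use W D n in simp_all)
  obtain R M where s: "initial_state adj = (R, M)" by (cases "initial_state adj")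
  from m.enumerate_com[OF m.initial_state_ok(1,2)[OF s]] m.initial_state_ok(3)[OF s]
  obtain t out s' where ex: "exec (?x ^ 6) (18 * (card (pverts G) + ?m + 1)) enumerate_com (initial_state adj) t out s'"
    and dist: "distinct (reported {} out)" and set: "set (reported {} out) = (\<Union>u<?n. m.family u)"
    and t: "t \<le> 10 + (\<Sum>u<?n. 31 + 30 * length (adj ! u)) + 120 * count_list out Rep"
    and low: "(\<Sum>u<?n. card {z. z < u \<and> (u, z) \<in> parcs G} + 2) \<le> 3 * count_list out Rep"
    unfolding wp_def s by blast
  have fam: "m.family r = {U \<in> connected_vertex_sets G. r \<in> U \<and> U \<subseteq> {..r}}" if "r < ?n" for r
    unfolding m.family_def by (rule grown_connected_vertex_sets[OF G V that]) auto
  have "(\<Union>u<?n. m.family u) = connected_vertex_sets G"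
  proof (intro subset_antisym subsetI)
    \<comment> \<open>The root whose search reports \<open>U\<close> is its maximum.\<close>
    fix U assume U: "U \<in> connected_vertex_sets G"
    then have sub: "U \<subseteq> {..<?n}" and "U \<noteq> {}"
      using V unfolding connected_vertex_sets_def connected_def strongly_connected_def by auto
    then have fin: "finite U" using finite_subset by blast
    then have "Max U \<in> U" "U \<subseteq> {..Max U}" using \<open>U \<noteq> {}\<close> by auto
    then show "U \<in> (\<Union>u<?n. m.family u)" using U sub fam by blast
  qed (use fam in auto)
  then have enum: "enumerates out (connected_vertex_sets G)"
    using dist set unfolding enumerates_def by simp
  have card: "card (connected_vertex_sets G) = count_list out Rep"
    using enum length_reported[of "{}" out] unfolding enumerates_def by (metis distinct_card)
  have "(\<Sum>u<?n. 31 + 30 * length (adj ! u)) = 31 * ?n + 30 * (2 * ?low)"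
    unfolding arcs[symmetric] by (simp add: sum.distrib sum_distrib_left)
  moreover have "?low + 2 * ?n \<le> 3 * count_list out Rep" using low unfolding sum.distrib by simp
  \<comment> \<open>The two sums are at most \<open>60 * (?low + 2 * ?n)\<close>, hence at most 180
    per solution; together with the 120 of the searches this gives 300.\<close>
  ultimately have tc: "t \<le> 10 + 300 * count_list out Rep" using t by linarith
  have "real t / real (card (connected_vertex_sets G)) \<le> 310"
  proof (cases "count_list out Rep = 0")
    \<comment> \<open>Without solutions the quotient is 0, the value of division by 0. Otherwise the
      additive 10 is charged to one solution, which gives 310.\<close>
    case True
    then show ?thesis unfolding card by simp
  next
    case False
    then have "t \<le> 310 * count_list out Rep" using tc by linarith
    then have "real t \<le> 310 * real (count_list out Rep)" using of_nat_mono by fastforce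
    then show ?thesis using False unfolding card by (simp add: divide_simps)
  qed
  then show "\<exists>t out s'.
         exec (?x ^ 6) (18 * (card (pverts G) + ?m + 1)) enumerate_com (initial_state adj) t out s' \<and>
         enumerates out (connected_vertex_sets G) \<and>
         real t / real (card (connected_vertex_sets G)) \<le> 310"
    using ex enum by blast
qed

end
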